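(* Let $n\ge3$ and let $M$ be a hypersurface in a space form $N^{n+1}(c)$ having at every point $x$ of $M$ three distinct principal curvatures $\lambda_0$, $\lambda_1$ and $\lambda_2$, with multiplicities $1$, $n_1$ and $n_2$, respectively. Put $\alpha=\lambda_0+\lambda_1+\lambda_2$, $\beta=-\lambda_0(\lambda_1+\lambda_2)-\lambda_1\lambda_2$, $\gamma=\lambda_0\lambda_1\lambda_2$, and define the tensor $A$ and the function $\mu$ on $M$ by $$A=S^{2}+\bigl((\alpha-\mathrm{tr}(H))^{2}+\beta-2(n-1)c\bigr)S+\Bigl((n-1)^{2}c^{2}-\bigl(\beta+(\alpha-\mathrm{tr}(H))^{2}\bigr)(n-1)c-\gamma(\alpha-2\,\mathrm{tr}(H))\Bigr)g,$$ $$\mu=\gamma+(\alpha-\mathrm{tr}(H))\bigl(\beta+\mathrm{tr}(H)(\alpha-\mathrm{tr}(H))\bigr).$$ Then on $M$ $$A=\mu\,H$$ and $$\mu=\bigl(\lambda_0+(n_1-1)\lambda_1+(n_2-1)\lambda_2\bigr)\Bigl(\lambda_1\lambda_2+(n_1\lambda_1+n_2\lambda_2)\bigl((n_1-1)\lambda_1+(n_2-1)\lambda_2\bigr)\Bigr).$$ Moreover: (i) if $\mu$ vanishes at a point $x\in M$, then $M$ is partially Einstein at this point; (ii) if $\mu$ is non-zero at a point $x\in M$, then $$R=\frac{1}{2\mu^{2}}\,A\wedge A+c\,G$$ holds on some neighbourhood $U\subset M$ of this point.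
   Context: $N^{n+1}(c)$ is a Riemannian space of constant curvature $c$, and $M$ is a connected hypersurface isometrically immersed in it, with induced metric $g$, curvature tensor $R$, Ricci tensor $S$, and second fundamental tensor $H$ (a symmetric $(0,2)$-tensor); the principal curvatures are the eigenvalues of the endomorphism $\mathcal{H}$ with $g(\mathcal{H}X,Y)=H(X,Y)$. Sign conventions are such that the Gauss equation reads $R_{hijk}=H_{hk}H_{ij}-H_{hj}H_{ik}+c\,G_{hijk}$, $G_{hijk}=g_{hk}g_{ij}-g_{hj}g_{ik}$, and $S_{hk}=g^{ij}R_{hijk}$. $\mathrm{tr}(H)=g^{ij}H_{ij}$. For a symmetric $(0,2)$-tensor $E$ the tensor $E^{2}$ has components $E^{2}_{hk}=g^{ij}E_{hi}E_{jk}$. For symmetric $(0,2)$-tensors $E,F$ the Kulkarni-Nomizu product is $(E\wedge F)(X_1,X_2,X_3,X_4)=E(X_1,X_4)F(X_2,X_3)+E(X_2,X_3)F(X_1,X_4)-E(X_1,X_3)F(X_2,X_4)-E(X_2,X_4)F(X_1,X_3)$, so $G=\frac12 g\wedge g$. $M$ is partially Einstein at a point $x$ (where $S$ is not proportional to $g$) if at $x$ one has $S^{2}=\lambda\,S+\nu\,g$ for some $\lambda,\nu\in\mathbb{R}$. *)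

theory Defs
  imports "HOL-Analysis.Analysis"
begin

primrec Ck_on :: "nat \<Rightarrow> 'a::euclidean_space set \<Rightarrow> ('a \<Rightarrow> 'b::real_normed_vector) \<Rightarrow> bool" where
  "Ck_on 0 S F \<longleftrightarrow> continuous_on S F"
| "Ck_on (Suc k) S F \<longleftrightarrow>
     (\<forall>x\<in>S. F differentiable (at x)) \<and> (\<forall>v. Ck_on k S (\<lambda>x. frechet_derivative F (at x) v))"

text \<open>\<open>C\<^sup>\<infinity>\<close>; intended for open sets only, as derivatives are taken at interior points.\<close>

definition smooth_on :: "'a::euclidean_space set \<Rightarrow> ('a \<Rightarrow> 'b::real_normed_vector) \<Rightarrow> bool" where
  "smooth_on S F \<longleftrightarrow> (\<forall>k. Ck_on k S F)"

text \<open>A chart is a pair of its domain and its coordinate map, the latter being relevant on the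
  domain only. The dimension of a manifold is the cardinality of the index type \<open>'n\<close>.\<close>

type_synonym ('m, 'n) chart = "'m set \<times> ('m \<Rightarrow> real ^ 'n)"

abbreviation dom_ch :: "('m, 'n) chart \<Rightarrow> 'm set" where
  "dom_ch \<phi> \<equiv> fst \<phi>"

abbreviation coords :: "('m, 'n) chart \<Rightarrow> 'm \<Rightarrow> real ^ 'n" where
  "coords \<phi> \<equiv> snd \<phi>"

abbreviation uncoords :: "('m, 'n) chart \<Rightarrow> real ^ 'n \<Rightarrow> 'm" where
  "uncoords \<phi> \<equiv> inv_into (dom_ch \<phi>) (coords \<phi>)"

definition is_chart :: "'m topology \<Rightarrow> ('m, 'n::finite) chart \<Rightarrow> bool" where
  "is_chart X \<phi> \<longleftrightarrow>
     openin X (dom_ch \<phi>) \<and> open (coords \<phi> ` dom_ch \<phi>) \<and>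
     homeomorphic_map (subtopology X (dom_ch \<phi>)) (top_of_set (coords \<phi> ` dom_ch \<phi>)) (coords \<phi>)"

definition loc_rep ::
    "('m, 'n) chart \<Rightarrow> ('q, 'k) chart \<Rightarrow> ('m \<Rightarrow> 'q) \<Rightarrow> real ^ 'n \<Rightarrow> real ^ 'k" where
  "loc_rep \<phi> \<psi> f = coords \<psi> \<circ> f \<circ> uncoords \<phi>"

abbreviation jac_at ::
    "('m, 'n::finite) chart \<Rightarrow> ('q, 'k::finite) chart \<Rightarrow> ('m \<Rightarrow> 'q) \<Rightarrow> 'm \<Rightarrow> real ^ 'n ^ 'k" where
  "jac_at \<phi> \<psi> f p \<equiv> jacobian (loc_rep \<phi> \<psi> f) (at (coords \<phi> p))"

definition smooth_map ::
    "'m topology \<Rightarrow> ('m, 'n::finite) chart set \<Rightarrow> 'q topology \<Rightarrow> ('q, 'k::finite) chart set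
      \<Rightarrow> ('m \<Rightarrow> 'q) \<Rightarrow> bool" where
  "smooth_map X \<A> Y \<B> f \<longleftrightarrow>
     continuous_map X Y f \<and>
     (\<forall>\<phi>\<in>\<A>. \<forall>\<psi>\<in>\<B>. smooth_on (coords \<phi> ` (dom_ch \<phi> \<inter> f -` dom_ch \<psi>)) (loc_rep \<phi> \<psi> f))"

text \<open>The atlas is not required to be maximal.\<close>

definition smooth_manifold :: "'m topology \<Rightarrow> ('m, 'n::finite) chart set \<Rightarrow> bool" where
  "smooth_manifold X \<A> \<longleftrightarrow>
     Hausdorff_space X \<and> second_countable X \<and>
     (\<forall>\<phi>\<in>\<A>. is_chart X \<phi>) \<and> (\<Union>\<phi>\<in>\<A>. dom_ch \<phi>) = topspace X \<and>
     (\<forall>\<phi>\<in>\<A>. \<forall>\<psi>\<in>\<A>. smooth_on (coords \<phi> ` (dom_ch \<phi> \<inter> dom_ch \<psi>)) (loc_rep \<phi> \<psi> id))"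

text \<open>A (0,2)-tensor field \<open>T\<close> is given by its component matrices: \<open>T \<phi> p $ i $ j\<close> is
  \<open>T(\<partial>\<^sub>i, \<partial>\<^sub>j)\<close> at the point \<open>p\<close>, with respect to the coordinates of the chart \<open>\<phi>\<close> around \<open>p\<close>.\<close>

type_synonym ('m, 'n) tensor2 = "('m, 'n) chart \<Rightarrow> 'm \<Rightarrow> real ^ 'n ^ 'n"

type_synonym 'n comp4 = "'n \<Rightarrow> 'n \<Rightarrow> 'n \<Rightarrow> 'n \<Rightarrow> real"

definition bil :: "real ^ 'n ^ 'n \<Rightarrow> real ^ 'n \<Rightarrow> real ^ 'n \<Rightarrow> real" where
  "bil E u v = (\<Sum>i\<in>UNIV. \<Sum>j\<in>UNIV. E $ i $ j * u $ i * v $ j)"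

definition pullback :: "real ^ 'n ^ 'k \<Rightarrow> real ^ 'k ^ 'k \<Rightarrow> real ^ 'n ^ 'n" where
  "pullback J E = transpose J ** E ** J"

definition sq_tensor :: "real ^ 'n ^ 'n \<Rightarrow> real ^ 'n ^ 'n \<Rightarrow> real ^ 'n ^ 'n" where
  "sq_tensor g E =
     (\<chi> h k. \<Sum>i\<in>UNIV. \<Sum>j\<in>UNIV. matrix_inv g $ i $ j * E $ h $ i * E $ j $ k)"

definition tr_tensor :: "real ^ 'n ^ 'n \<Rightarrow> real ^ 'n ^ 'n \<Rightarrow> real" where
  "tr_tensor g E = (\<Sum>i\<in>UNIV. \<Sum>j\<in>UNIV. matrix_inv g $ i $ j * E $ i $ j)"

definition kulkarni_nomizu :: "real ^ 'n ^ 'n \<Rightarrow> real ^ 'n ^ 'n \<Rightarrow> 'n comp4" where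
  "kulkarni_nomizu E F h i j k =
     E $ h $ k * F $ i $ j + E $ i $ j * F $ h $ k - E $ h $ j * F $ i $ k - E $ i $ k * F $ h $ j"

definition G_tensor :: "real ^ 'n ^ 'n \<Rightarrow> 'n comp4" where
  "G_tensor g h i j k = g $ h $ k * g $ i $ j - g $ h $ j * g $ i $ k"

definition riemannian_metric :: "('m, 'n::finite) chart set \<Rightarrow> ('m, 'n) tensor2 \<Rightarrow> bool" where
  "riemannian_metric \<A> g \<longleftrightarrow>
     (\<forall>\<phi>\<in>\<A>. smooth_on (coords \<phi> ` dom_ch \<phi>) (g \<phi> \<circ> uncoords \<phi>)) \<and>
     (\<forall>\<phi>\<in>\<A>. \<forall>p\<in>dom_ch \<phi>.
        transpose (g \<phi> p) = g \<phi> p \<and> (\<forall>v. v \<noteq> 0 \<longrightarrow> bil (g \<phi> p) v v > 0)) \<and>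
     (\<forall>\<phi>\<in>\<A>. \<forall>\<psi>\<in>\<A>. \<forall>p\<in>dom_ch \<phi> \<inter> dom_ch \<psi>. g \<phi> p = pullback (jac_at \<phi> \<psi> id p) (g \<psi> p))"

definition riemannian_manifold ::
    "'m topology \<Rightarrow> ('m, 'n::finite) chart set \<Rightarrow> ('m, 'n) tensor2 \<Rightarrow> bool" where
  "riemannian_manifold X \<A> g \<longleftrightarrow> smooth_manifold X \<A> \<and> riemannian_metric \<A> g"

definition partial :: "'n \<Rightarrow> (real ^ 'n::finite \<Rightarrow> real) \<Rightarrow> real ^ 'n \<Rightarrow> real" where
  "partial i F x = frechet_derivative F (at x) (axis i 1)"

text \<open>Here \<open>g\<close> is the matrix of a metric as a function of the coordinates, and
  \<open>christoffel g x m i j\<close> is \<open>\<Gamma>\<^sup>m\<^sub>i\<^sub>j\<close> at \<open>x\<close>.\<close>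

definition christoffel ::
    "(real ^ 'n::finite \<Rightarrow> real ^ 'n ^ 'n) \<Rightarrow> real ^ 'n \<Rightarrow> 'n \<Rightarrow> 'n \<Rightarrow> 'n \<Rightarrow> real" where
  "christoffel g x m i j =
     (1/2) * (\<Sum>l\<in>UNIV. matrix_inv (g x) $ m $ l *
        (partial i (\<lambda>y. g y $ j $ l) x + partial j (\<lambda>y. g y $ i $ l) x
         - partial l (\<lambda>y. g y $ i $ j) x))"

text \<open>\<open>R\<^sub>h\<^sub>i\<^sub>j\<^sub>k = g(\<nabla>\<^sub>h \<nabla>\<^sub>i \<partial>\<^sub>j - \<nabla>\<^sub>i \<nabla>\<^sub>h \<partial>\<^sub>j, \<partial>\<^sub>k)\<close>. With this sign the unit sphere has \<open>R = G\<close>.\<close>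

definition riemann_coord :: "(real ^ 'n::finite \<Rightarrow> real ^ 'n ^ 'n) \<Rightarrow> real ^ 'n \<Rightarrow> 'n comp4" where
  "riemann_coord g x h i j k =
     (\<Sum>m\<in>UNIV. g x $ m $ k *
        (partial h (\<lambda>y. christoffel g y m i j) x - partial i (\<lambda>y. christoffel g y m h j) x
         + (\<Sum>l\<in>UNIV. christoffel g x l i j * christoffel g x m h l
                    - christoffel g x l h j * christoffel g x m i l)))"

definition curv :: "('m, 'n::finite) tensor2 \<Rightarrow> ('m, 'n) chart \<Rightarrow> 'm \<Rightarrow> 'n comp4" where
  "curv g \<phi> p = riemann_coord (g \<phi> \<circ> uncoords \<phi>) (coords \<phi> p)"

definition ricci :: "('m, 'n::finite) tensor2 \<Rightarrow> ('m, 'n) tensor2" where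
  "ricci g \<phi> p =
     (\<chi> h k. \<Sum>i\<in>UNIV. \<Sum>j\<in>UNIV. matrix_inv (g \<phi> p) $ i $ j * curv g \<phi> p h i j k)"

definition sectional_curvature ::
    "('m, 'n::finite) tensor2 \<Rightarrow> ('m, 'n) chart \<Rightarrow> 'm \<Rightarrow> real ^ 'n \<Rightarrow> real ^ 'n \<Rightarrow> real" where
  "sectional_curvature g \<phi> p u v =
     (\<Sum>h\<in>UNIV. \<Sum>i\<in>UNIV. \<Sum>j\<in>UNIV. \<Sum>k\<in>UNIV.
         curv g \<phi> p h i j k * u $ h * v $ i * v $ j * u $ k)
     / (bil (g \<phi> p) u u * bil (g \<phi> p) v v - (bil (g \<phi> p) u v)\<^sup>2)"

definition constant_curvature ::
    "('m, 'n::finite) chart set \<Rightarrow> ('m, 'n) tensor2 \<Rightarrow> real \<Rightarrow> bool" where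
  "constant_curvature \<A> g c \<longleftrightarrow>
     (\<forall>\<phi>\<in>\<A>. \<forall>p\<in>dom_ch \<phi>. \<forall>u v. u \<noteq> v \<and> independent {u, v} \<longrightarrow>
        sectional_curvature g \<phi> p u v = c)"

definition isometric_immersion ::
    "'m topology \<Rightarrow> ('m, 'n::finite) chart set \<Rightarrow> ('m, 'n) tensor2 \<Rightarrow>
     'q topology \<Rightarrow> ('q, 'k::finite) chart set \<Rightarrow> ('q, 'k) tensor2 \<Rightarrow> ('m \<Rightarrow> 'q) \<Rightarrow> bool" where
  "isometric_immersion X \<A> g Y \<B> h f \<longleftrightarrow>
     smooth_map X \<A> Y \<B> f \<and>
     (\<forall>\<phi>\<in>\<A>. \<forall>\<psi>\<in>\<B>. \<forall>p\<in>dom_ch \<phi> \<inter> f -` dom_ch \<psi>.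
        inj ((*v) (jac_at \<phi> \<psi> f p)) \<and>
        g \<phi> p = pullback (jac_at \<phi> \<psi> f p) (h \<psi> (f p)))"

text \<open>A choice of a unit normal vector at every point of the hypersurface; \<open>\<nu> \<psi> p\<close> is the
  component vector with respect to a chart \<open>\<psi>\<close> of the ambient space around \<open>f p\<close>. The vector is
  determined up to sign, and no continuity of the choice is required, so that the hypersurface
  need not be two-sided.\<close>

definition unit_normal ::
    "('m, 'n::finite) chart set \<Rightarrow> ('q, 'k::finite) chart set \<Rightarrow> ('q, 'k) tensor2 \<Rightarrow> ('m \<Rightarrow> 'q)
      \<Rightarrow> (('q, 'k) chart \<Rightarrow> 'm \<Rightarrow> real ^ 'k) \<Rightarrow> bool" where
  "unit_normal \<A> \<B> h f \<nu> \<longleftrightarrow>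
     (\<forall>\<phi>\<in>\<A>. \<forall>p\<in>dom_ch \<phi>. \<forall>\<psi>\<in>\<B>. f p \<in> dom_ch \<psi> \<longrightarrow>
        bil (h \<psi> (f p)) (\<nu> \<psi> p) (\<nu> \<psi> p) = 1 \<and>
        (\<forall>u. bil (h \<psi> (f p)) (jac_at \<phi> \<psi> f p *v u) (\<nu> \<psi> p) = 0) \<and>
        (\<forall>\<psi>'\<in>\<B>. f p \<in> dom_ch \<psi>' \<longrightarrow> \<nu> \<psi>' p = jac_at \<psi> \<psi>' id (f p) *v \<nu> \<psi> p))"

text \<open>The components in the chart \<open>\<psi>\<close> of the ambient covariant derivative of \<open>df(\<partial>\<^sub>j)\<close>
  in the direction \<open>df(\<partial>\<^sub>i)\<close>, at \<open>f p\<close>.\<close>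

definition ambient_hessian ::
    "('q, 'k::finite) tensor2 \<Rightarrow> ('m \<Rightarrow> 'q) \<Rightarrow> ('m, 'n::finite) chart \<Rightarrow> ('q, 'k) chart \<Rightarrow> 'm
      \<Rightarrow> 'n \<Rightarrow> 'n \<Rightarrow> real ^ 'k" where
  "ambient_hessian h f \<phi> \<psi> p i j =
     (let F = loc_rep \<phi> \<psi> f; x = coords \<phi> p in
      \<chi> a. partial i (partial j (\<lambda>y. F y $ a)) x +
          (\<Sum>b\<in>UNIV. \<Sum>d\<in>UNIV. christoffel (h \<psi> \<circ> uncoords \<psi>) (F x) a b d *
             partial i (\<lambda>y. F y $ b) x * partial j (\<lambda>y. F y $ d) x))"

definition second_fundamental_tensor ::
    "('m, 'n::finite) chart set \<Rightarrow> ('q, 'k::finite) chart set \<Rightarrow> ('q, 'k) tensor2 \<Rightarrow> ('m \<Rightarrow> 'q)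
      \<Rightarrow> (('q, 'k) chart \<Rightarrow> 'm \<Rightarrow> real ^ 'k) \<Rightarrow> ('m, 'n) tensor2 \<Rightarrow> bool" where
  "second_fundamental_tensor \<A> \<B> h f \<nu> H \<longleftrightarrow>
     (\<forall>\<phi>\<in>\<A>. \<forall>p\<in>dom_ch \<phi>. \<forall>\<psi>\<in>\<B>. f p \<in> dom_ch \<psi> \<longrightarrow>
        H \<phi> p = (\<chi> i j. bil (h \<psi> (f p)) (ambient_hessian h f \<phi> \<psi> p i j) (\<nu> \<psi> p)))"

text \<open>The endomorphism \<open>\<H>\<close> with \<open>g(\<H> u, v) = H(u, v)\<close>.\<close>

definition shape_operator :: "real ^ 'n ^ 'n \<Rightarrow> real ^ 'n ^ 'n \<Rightarrow> real ^ 'n \<Rightarrow> real ^ 'n" where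
  "shape_operator g H u = (THE w. \<forall>v. bil g w v = bil H u v)"

definition eigenspace :: "('a \<Rightarrow> 'a::real_vector) \<Rightarrow> real \<Rightarrow> 'a set" where
  "eigenspace L e = {v. L v = e *\<^sub>R v}"

definition eigenvalues :: "('a \<Rightarrow> 'a::real_vector) \<Rightarrow> real set" where
  "eigenvalues L = {e. \<exists>v. v \<noteq> 0 \<and> L v = e *\<^sub>R v}"

text \<open>The trace does not depend on the chart around \<open>p\<close>; choosing one makes it a function of
  the point alone.\<close>

definition trace_fn ::
    "('m, 'n::finite) chart set \<Rightarrow> ('m, 'n) tensor2 \<Rightarrow> ('m, 'n) tensor2 \<Rightarrow> 'm \<Rightarrow> real" where
  "trace_fn \<A> g E p = (let \<phi> = SOME \<phi>. \<phi> \<in> \<A> \<and> p \<in> dom_ch \<phi> in tr_tensor (g \<phi> p) (E \<phi> p))"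

definition partially_einstein_at ::
    "('m, 'n::finite) chart set \<Rightarrow> ('m, 'n) tensor2 \<Rightarrow> 'm \<Rightarrow> bool" where
  "partially_einstein_at \<A> g p \<longleftrightarrow>
     \<not> (\<exists>\<kappa>. \<forall>\<phi>\<in>\<A>. p \<in> dom_ch \<phi> \<longrightarrow> ricci g \<phi> p = \<kappa> *\<^sub>R g \<phi> p) \<and>
     (\<exists>lam nu. \<forall>\<phi>\<in>\<A>. p \<in> dom_ch \<phi> \<longrightarrow>
        sq_tensor (g \<phi> p) (ricci g \<phi> p) = lam *\<^sub>R ricci g \<phi> p + nu *\<^sub>R g \<phi> p)"

end

theory Submission
  imports Defs
begin

text \<open>For an isometric map both the curvature of the domain and the ambient curvature along the map
  are obtained by differentiating \<open>h(\<nabla>\<^sub>i df(\<partial>\<^sub>j), df(\<partial>\<^sub>k))\<close>, which depends on the induced metric only;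
  comparing the two yields the Gauss equation, without a derivative of the unit normal. It gives
  \<open>S = t H - H\<^sup>2 + (n - 1) c g\<close> with \<open>t = tr H\<close>, so that \<open>S\<close> and \<open>H\<close> are simultaneously
  diagonalizable and \<open>A = \<mu> H\<close> may be checked on the three eigenvalues. The function \<open>\<mu>\<close> is the product
  of the three factors \<open>t - \<lambda>\<^sub>i - \<lambda>\<^sub>j\<close>, and the difference of two eigenvalues of \<open>S\<close> is
  \<open>(\<lambda>\<^sub>i - \<lambda>\<^sub>j)(t - \<lambda>\<^sub>i - \<lambda>\<^sub>j)\<close>. Hence \<open>\<mu> \<noteq> 0\<close> holds exactly where \<open>g\<close>, \<open>S\<close>, \<open>S\<^sup>2\<close> are linearly
  independent. This is an open condition by continuity of \<open>S\<close> alone; neither \<open>H\<close> nor the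
  principal curvatures are known to depend continuously on the point.\<close>

section \<open>Directional derivatives\<close>

text \<open>The space form is given by its sectional curvatures only; its full curvature tensor has
  to be recovered by polarization, and for this all algebraic symmetries of the curvature are
  established from the coordinate definition. The coefficients of \<open>A\<close> come from the
  cubic \<open>x^3 = \<alpha> x^2 + \<beta> x + \<gamma>\<close> satisfied by the three principal
  curvatures: it lowers the square of \<open>t x - x^2\<close> to degree two, and a multiple of
  \<open>t x - x^2\<close> then removes what is quadratic, so that \<open>\<mu> x\<close> and a
  constant remain. In (i) the equation \<open>A = 0\<close> is itself the required relation, and
  only the failure of proportionality of \<open>S\<close> and \<open>g\<close> needs a separate
  argument. In (ii) the identity for \<open>R\<close> is pointwise algebra,
  \<open>A = \<mu> H\<close> inserted in the Gauss equation; the neighbourhood is the only part that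
  is not pointwise.\<close>

abbreviation dird :: "'a::real_normed_vector \<Rightarrow> ('a \<Rightarrow> 'b::real_normed_vector) \<Rightarrow> 'a \<Rightarrow> 'b" where
  "dird v F x \<equiv> frechet_derivative F (at x) v"

lemma smooth_on_differentiable:
  assumes "smooth_on S F" "x \<in> S"
  shows "F differentiable (at x)"
proof -
  have "Ck_on (Suc 0) S F"
    using assms(1) unfolding smooth_on_def by blast
  then show ?thesis using assms(2) by simp
qed

lemma smooth_on_dird:
  assumes "smooth_on S F"
  shows "smooth_on S (dird v F)"
  unfolding smooth_on_def
proof
  fix k
  have "Ck_on (Suc k) S F" using assms unfolding smooth_on_def by blast
  then show "Ck_on k S (dird v F)" by simp
qed

lemma smooth_on_continuous:
  assumes "smooth_on S F"
  shows "continuous_on S F"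
proof -
  have "Ck_on 0 S F" using assms unfolding smooth_on_def by blast
  then show ?thesis by simp
qed

lemma Ck_on_subset: "Ck_on k S F \<Longrightarrow> T \<subseteq> S \<Longrightarrow> Ck_on k T F"
  by (induction k arbitrary: F) (auto intro: continuous_on_subset)

lemma smooth_on_subset: "smooth_on S F \<Longrightarrow> T \<subseteq> S \<Longrightarrow> smooth_on T F"
  unfolding smooth_on_def using Ck_on_subset by blast

lemma dird_works: "F differentiable (at x) \<Longrightarrow> (F has_derivative (\<lambda>v. dird v F x)) (at x)"
  by (simp add: frechet_derivative_works)

lemma dird_eqI: "(F has_derivative F') (at x) \<Longrightarrow> dird v F x = F' v"
  by (metis frechet_derivative_at)

lemma dird_bounded_linear:
  assumes "bounded_linear T" "F differentiable (at x)"
  shows "dird v (\<lambda>y. T (F y)) x = T (dird v F x)"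
  by (rule dird_eqI) (rule bounded_linear.has_derivative[OF assms(1) dird_works[OF assms(2)]])

lemma dird_cong_open:
  assumes "open U" "x \<in> U" "\<And>y. y \<in> U \<Longrightarrow> F y = G y" "F differentiable (at x)"
  shows "dird v F x = dird v G x"
  using frechet_derivative_transform_within_open[OF assms(4,1,2,3)] by simp

lemma partial_nth:
  assumes "F differentiable (at x)"
  shows "partial i (\<lambda>y. F y $ a) x = dird (axis i 1) F x $ a"
  unfolding partial_def by (rule dird_bounded_linear[OF bounded_linear_vec_nth assms])

lemma partial_nth_nth:
  assumes "F differentiable (at x)"
  shows "partial i (\<lambda>y. F y $ a $ b) x = dird (axis i 1) F x $ a $ b"
  unfolding partial_def
  by (rule dird_bounded_linear[of "\<lambda>z. z $ a $ b", OF _ assms])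
     (intro bounded_linear_compose[OF bounded_linear_vec_nth] bounded_linear_vec_nth)

text \<open>The mean value theorem is applied twice: along \<open>u\<close> to the increment
  \<open>p\<close> of \<open>f\<close> across \<open>s\<close> times \<open>v\<close>, then along
  \<open>v\<close> to \<open>fu\<close>. Only derivatives along lines enter.\<close>

lemma second_difference:
  fixes f :: "'a::real_normed_vector \<Rightarrow> real"
  assumes fu: "\<And>y. y \<in> U \<Longrightarrow> ((\<lambda>t. f (y + t *\<^sub>R u)) has_real_derivative fu y) (at 0)"
    and fuv: "\<And>y. y \<in> U \<Longrightarrow> ((\<lambda>t. fu (y + t *\<^sub>R v)) has_real_derivative fuv y) (at 0)"
    and s: "0 < s" "\<And>a b. 0 \<le> a \<Longrightarrow> a \<le> s \<Longrightarrow> 0 \<le> b \<Longrightarrow> b \<le> s \<Longrightarrow> x + a *\<^sub>R u + b *\<^sub>R v \<in> U"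
  shows "\<exists>a b. 0 < a \<and> a < s \<and> 0 < b \<and> b < s \<and>
           f (x + s *\<^sub>R u + s *\<^sub>R v) - f (x + s *\<^sub>R u) - f (x + s *\<^sub>R v) + f x
             = s * (s * fuv (x + a *\<^sub>R u + b *\<^sub>R v))"
proof -
  \<comment> \<open>The hypotheses give derivatives at parameter \<open>0\<close> only; moving the
    base point along the line yields them at every parameter.\<close>
  have shift: "((\<lambda>t. k (y + t *\<^sub>R w)) has_real_derivative k') (at t)"
    if "((\<lambda>r. k ((y + t *\<^sub>R w) + r *\<^sub>R w)) has_real_derivative k') (at 0)"
    for k :: "'a \<Rightarrow> real" and y w k' t
  proof -
    have "((\<lambda>r. k (y + (r + t) *\<^sub>R w)) has_real_derivative k') (at 0)"
      using that by (simp add: algebra_simps)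
    then show ?thesis using DERIV_shift[of "\<lambda>r. k (y + r *\<^sub>R w)" k' 0 t] by simp
  qed
  define p where "p t = f (x + t *\<^sub>R u + s *\<^sub>R v) - f (x + t *\<^sub>R u)" for t
  have "\<exists>a>0. a < s \<and> p s - p 0 = (s - 0) * (fu (x + a *\<^sub>R u + s *\<^sub>R v) - fu (x + a *\<^sub>R u))"
  proof (rule MVT2)
    fix t assume t: "0 \<le> t" "t \<le> s"
    have 1: "((\<lambda>t. f ((x + s *\<^sub>R v) + t *\<^sub>R u)) has_real_derivative fu ((x + s *\<^sub>R v) + t *\<^sub>R u)) (at t)"
      by (rule shift, rule fu) (use s(2)[of t s] t s(1) in \<open>simp add: algebra_simps\<close>)
    have 2: "((\<lambda>t. f (x + t *\<^sub>R u)) has_real_derivative fu (x + t *\<^sub>R u)) (at t)"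
      by (rule shift, rule fu) (use s(2)[of t 0] t s(1) in simp)
    show "(p has_real_derivative fu (x + t *\<^sub>R u + s *\<^sub>R v) - fu (x + t *\<^sub>R u)) (at t)"
      unfolding p_def using DERIV_diff[OF 1 2] by (simp add: algebra_simps)
  qed (use s in simp)
  then obtain a where a: "0 < a" "a < s"
    "p s - p 0 = s * (fu (x + a *\<^sub>R u + s *\<^sub>R v) - fu (x + a *\<^sub>R u))" by auto
  have "\<exists>b>0. b < s \<and> fu (x + a *\<^sub>R u + s *\<^sub>R v) - fu (x + a *\<^sub>R u + 0 *\<^sub>R v)
           = (s - 0) * fuv (x + a *\<^sub>R u + b *\<^sub>R v)"
  proof (rule MVT2)
    fix t assume t: "0 \<le> t" "t \<le> s"
    show "((\<lambda>t. fu (x + a *\<^sub>R u + t *\<^sub>R v)) has_real_derivative fuv (x + a *\<^sub>R u + t *\<^sub>R v)) (at t)"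
      by (rule shift, rule fuv) (use s(2)[of a t] t a in simp)
  qed (use s in simp)
  then obtain b where b: "0 < b" "b < s"
    "fu (x + a *\<^sub>R u + s *\<^sub>R v) - fu (x + a *\<^sub>R u) = s * fuv (x + a *\<^sub>R u + b *\<^sub>R v)" by auto
  have "p s - p 0 = s * (s * fuv (x + a *\<^sub>R u + b *\<^sub>R v))"
    using a(3) b(3) by simp
  then show ?thesis using a b unfolding p_def by (intro exI[of _ a] exI[of _ b]) simp
qed

text \<open>The second difference of \<open>f\<close> over a parallelogram is symmetric in
  \<open>u\<close> and \<open>v\<close>, while \<open>second_difference\<close> equates it with
  \<open>s^2\<close> times \<open>fuv\<close> at one nearby point and with \<open>s^2\<close> times
  \<open>fvu\<close> at another. Continuity carries the equality to \<open>x\<close>.\<close>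

lemma symmetric_mixed_derivative:
  fixes f :: "'a::real_normed_vector \<Rightarrow> real"
  assumes U: "open U" "x \<in> U"
    and fu: "\<And>y. y \<in> U \<Longrightarrow> ((\<lambda>t. f (y + t *\<^sub>R u)) has_real_derivative fu y) (at 0)"
    and fv: "\<And>y. y \<in> U \<Longrightarrow> ((\<lambda>t. f (y + t *\<^sub>R v)) has_real_derivative fv y) (at 0)"
    and fuv: "\<And>y. y \<in> U \<Longrightarrow> ((\<lambda>t. fu (y + t *\<^sub>R v)) has_real_derivative fuv y) (at 0)"
    and fvu: "\<And>y. y \<in> U \<Longrightarrow> ((\<lambda>t. fv (y + t *\<^sub>R u)) has_real_derivative fvu y) (at 0)"
    and cont: "continuous_on U fuv" "continuous_on U fvu"
  shows "fuv x = fvu x"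
proof (rule ccontr)
  assume ne: "fuv x \<noteq> fvu x"
  \<comment> \<open>Half the gap: two deviations below \<open>e\<close> cannot bridge it.\<close>
  define e where "e = \<bar>fuv x - fvu x\<bar> / 2"
  have e: "e > 0" using ne unfolding e_def by simp
  obtain d0 where d0: "d0 > 0" "ball x d0 \<subseteq> U" using U openE by blast
  obtain d1 where d1: "d1 > 0" "\<And>y. y \<in> U \<Longrightarrow> dist y x < d1 \<Longrightarrow> dist (fuv y) (fuv x) < e"
    using cont(1) U(2) e unfolding continuous_on_iff by meson
  obtain d2 where d2: "d2 > 0" "\<And>y. y \<in> U \<Longrightarrow> dist y x < d2 \<Longrightarrow> dist (fvu y) (fvu x) < e"
    using cont(2) U(2) e unfolding continuous_on_iff by meson
  define d where "d = min d0 (min d1 d2)"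
  \<comment> \<open>Keeps the whole parallelogram within \<open>d / 2\<close> of \<open>x\<close>;
    the summand \<open>1\<close> guards against \<open>u = v = 0\<close>.\<close>
  define s where "s = d / (2 * (norm u + norm v + 1))"
  have d: "d > 0" using d0 d1 d2 unfolding d_def by simp
  have pos: "norm u + norm v + 1 > 0" by (smt (verit) norm_ge_zero)
  have s: "s > 0" using d pos unfolding s_def by simp
  have near: "dist (x + a *\<^sub>R u + b *\<^sub>R v) x < d"
    if "0 \<le> a" "a \<le> s" "0 \<le> b" "b \<le> s" for a b
  proof -
    have "dist (x + a *\<^sub>R u + b *\<^sub>R v) x = norm (a *\<^sub>R u + b *\<^sub>R v)"
      by (simp add: dist_norm algebra_simps)
    also have "\<dots> \<le> a * norm u + b * norm v"
      using norm_triangle_ineq[of "a *\<^sub>R u" "b *\<^sub>R v"] that by simp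
    also have "\<dots> \<le> s * norm u + s * norm v"
      using that by (intro add_mono mult_right_mono) auto
    also have "\<dots> \<le> s * (norm u + norm v + 1)" using s by (simp add: algebra_simps)
    also have "\<dots> = d / 2" unfolding s_def using pos by (simp add: field_split_simps)
    finally show ?thesis using d by simp
  qed
  have inU: "x + a *\<^sub>R u + b *\<^sub>R v \<in> U"
    if "0 \<le> a" "a \<le> s" "0 \<le> b" "b \<le> s" for a b
    using near[OF that] d0(2) unfolding d_def by (auto simp: dist_commute subset_iff)
  have inU': "x + a *\<^sub>R v + b *\<^sub>R u \<in> U"
    if "0 \<le> a" "a \<le> s" "0 \<le> b" "b \<le> s" for a b
    using inU[of b a] that by (simp add: algebra_simps)
  obtain a b where ab: "0 < a" "a < s" "0 < b" "b < s"
    "f (x + s *\<^sub>R u + s *\<^sub>R v) - f (x + s *\<^sub>R u) - f (x + s *\<^sub>R v) + f x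
       = s * (s * fuv (x + a *\<^sub>R u + b *\<^sub>R v))"
    using second_difference[OF fu fuv s inU] by blast
  obtain a' b' where ab': "0 < a'" "a' < s" "0 < b'" "b' < s"
    "f (x + s *\<^sub>R v + s *\<^sub>R u) - f (x + s *\<^sub>R v) - f (x + s *\<^sub>R u) + f x
       = s * (s * fvu (x + a' *\<^sub>R v + b' *\<^sub>R u))"
    using second_difference[OF fv fvu s inU'] by blast
  have pt: "x + s *\<^sub>R v + s *\<^sub>R u = x + s *\<^sub>R u + s *\<^sub>R v" by (simp add: algebra_simps)
  have "s * (s * fuv (x + a *\<^sub>R u + b *\<^sub>R v)) = s * (s * fvu (x + a' *\<^sub>R v + b' *\<^sub>R u))"
    using ab(5) ab'(5) unfolding pt by linarith
  with s have eq: "fuv (x + a *\<^sub>R u + b *\<^sub>R v) = fvu (x + a' *\<^sub>R v + b' *\<^sub>R u)"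
    by simp
  have "dist (fuv (x + a *\<^sub>R u + b *\<^sub>R v)) (fuv x) < e"
    using ab near[of a b] inU[of a b] by (intro d1(2)) (auto simp: d_def)
  moreover have "dist (fvu (x + a' *\<^sub>R v + b' *\<^sub>R u)) (fvu x) < e"
  proof (rule d2(2))
    show "x + a' *\<^sub>R v + b' *\<^sub>R u \<in> U" using ab' inU'[of a' b'] by simp
    have "x + a' *\<^sub>R v + b' *\<^sub>R u = x + b' *\<^sub>R u + a' *\<^sub>R v" by (simp add: algebra_simps)
    moreover have "dist (x + b' *\<^sub>R u + a' *\<^sub>R v) x < d2" using ab' near[of b' a'] by (simp add: d_def)
    ultimately show "dist (x + a' *\<^sub>R v + b' *\<^sub>R u) x < d2" by metis
  qed
  ultimately show False using eq unfolding e_def dist_real_def by (smt (verit) field_sum_of_halves)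
qed

lemma has_real_derivative_line:
  assumes "(F has_derivative F') (at (y::'a::real_normed_vector))"
  shows "((\<lambda>t. F (y + t *\<^sub>R v)) has_real_derivative F' v) (at 0)"
proof -
  have 1: "((\<lambda>t. y + t *\<^sub>R v) has_derivative (\<lambda>t. t *\<^sub>R v)) (at (0::real))"
    by (auto intro!: derivative_eq_intros)
  have "(F \<circ> (\<lambda>t. y + t *\<^sub>R v) has_derivative F' \<circ> (\<lambda>t. t *\<^sub>R v)) (at 0)"
    by (rule diff_chain_at[OF 1]) (use assms in simp)
  moreover have "F' \<circ> (\<lambda>t. t *\<^sub>R v) = (*) (F' v)"
    using linear_scale[OF has_derivative_linear[OF assms]] by (auto simp: fun_eq_iff)
  ultimately show ?thesis by (simp add: has_field_derivative_def o_def)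
qed

text \<open>Pairing with an arbitrary \<open>w\<close> makes the values real, so the scalar result
  applies to vector and matrix valued maps alike.\<close>

lemma dird_commute:
  fixes F :: "'a::euclidean_space \<Rightarrow> 'b::real_inner"
  assumes U: "open U" "x \<in> U" and F: "smooth_on U F"
  shows "dird u (dird v F) x = dird v (dird u F) x"
proof -
  have line: "((\<lambda>t. K (y + t *\<^sub>R a) \<bullet> w) has_real_derivative dird a K y \<bullet> w) (at 0)"
    if "smooth_on U K" "y \<in> U" for K :: "'a \<Rightarrow> 'b" and y a w
  proof -
    have "((\<lambda>y. K y \<bullet> w) has_derivative (\<lambda>v. dird v K y \<bullet> w)) (at y)"
      using dird_works[OF smooth_on_differentiable[OF that]]
      by (auto intro!: derivative_eq_intros)
    from has_real_derivative_line[OF this] show ?thesis .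
  qed
  have "dird u (dird v F) x \<bullet> w = dird v (dird u F) x \<bullet> w" for w
  proof (rule symmetric_mixed_derivative[OF U, symmetric,
        where f="\<lambda>y. F y \<bullet> w" and u=u and v=v and fu="\<lambda>y. dird u F y \<bullet> w" and fv="\<lambda>y. dird v F y \<bullet> w"])
    show "continuous_on U (\<lambda>y. dird v (dird u F) y \<bullet> w)" "continuous_on U (\<lambda>y. dird u (dird v F) y \<bullet> w)"
      by (intro continuous_on_inner continuous_on_const smooth_on_continuous smooth_on_dird F)+
  qed (intro line F smooth_on_dird; assumption)+
  then show ?thesis using vector_eq_rdot[of "dird u (dird v F) x" "dird v (dird u F) x"] by (simp add: inner_commute)
qed

section \<open>Bilinear forms\<close>

lemma bil_inner: "bil E u v = u \<bullet> (E *v v)"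
  by (simp add: bil_def inner_vec_def matrix_vector_mult_def sum_distrib_left mult_ac)

lemma bil_add_left: "bil E (u + u') v = bil E u v + bil E u' v"
  and bil_diff_left: "bil E (u - u') v = bil E u v - bil E u' v"
  and bil_scaleR_left: "bil E (r *\<^sub>R u) v = r * bil E u v"
  and bil_minus_left: "bil E (- u) v = - bil E u v"
  and bil_zero_left [simp]: "bil E 0 v = 0"
  by (simp_all add: bil_inner inner_add_left inner_diff_left)

lemma bil_add_right: "bil E u (v + v') = bil E u v + bil E u v'"
  and bil_diff_right: "bil E u (v - v') = bil E u v - bil E u v'"
  and bil_scaleR_right: "bil E u (r *\<^sub>R v) = r * bil E u v"
  and bil_minus_right: "bil E u (- v) = - bil E u v"
  and bil_zero_right [simp]: "bil E u 0 = 0"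
  by (simp_all add: bil_inner inner_add_right inner_diff_right matrix_vector_right_distrib
      matrix_vector_mult_diff_distrib matrix_vector_mult_scaleR
      linear_neg[OF matrix_vector_mul_linear])

lemmas bil_linear = bil_add_left bil_diff_left bil_scaleR_left bil_minus_left
  bil_add_right bil_diff_right bil_scaleR_right bil_minus_right

lemma bil_add_form: "bil (E + E') u v = bil E u v + bil E' u v"
  and bil_scaleR_form: "bil (r *\<^sub>R E) u v = r * bil E u v"
  by (simp_all add: bil_def sum.distrib sum_distrib_left algebra_simps)

lemma bil_axis: "bil E (axis i 1) (axis j 1) = E $ i $ j"
  by (simp add: bil_inner inner_axis' matrix_vector_mult_basis column_def)

lemma bil_sym: "transpose E = E \<Longrightarrow> bil E u v = bil E v u"
  by (metis bil_inner dot_lmul_matrix inner_commute transpose_matrix_vector)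

lemma vec_expand: "(u :: real ^ 'n) = (\<Sum>i\<in>UNIV. u $ i *\<^sub>R axis i 1)"
  using basis_expansion[of u] by (simp add: scalar_mult_eq_scaleR)

lemma bounded_bilinear_matrix_vector:
  "bounded_bilinear (\<lambda>(A :: real ^ 'n ^ 'm) v. A *v v)"
  by (rule bilinear_conv_bounded_bilinear[THEN iffD1])
    (auto simp: bilinear_def intro!: linearI simp: matrix_vector_right_distrib matrix_vector_mult_scaleR
      matrix_vector_mult_add_rdistrib scaleR_matrix_vector_assoc)

lemma bil_has_derivative:
  assumes "(E has_derivative E') (at x)" "(u has_derivative u') (at x)" "(v has_derivative v') (at x)"
  shows "((\<lambda>y. bil (E y) (u y) (v y)) has_derivative
     (\<lambda>d. bil (E' d) (u x) (v x) + bil (E x) (u' d) (v x) + bil (E x) (u x) (v' d))) (at x)"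
proof -
  have "((\<lambda>y. u y \<bullet> (E y *v v y)) has_derivative
     (\<lambda>d. u x \<bullet> (E x *v v' d + E' d *v v x) + u' d \<bullet> (E x *v v x))) (at x)"
    using assms bounded_bilinear.FDERIV[OF bounded_bilinear_matrix_vector assms(1,3)]
    by (intro has_derivative_inner) auto
  then show ?thesis by (simp add: bil_inner inner_add_right algebra_simps)
qed

lemma bil_differentiable:
  assumes "E differentiable (at x)" "u differentiable (at x)" "v differentiable (at x)"
  shows "(\<lambda>y. bil (E y) (u y) (v y)) differentiable (at x)"
  using bil_has_derivative assms unfolding differentiable_def by blast

lemma dird_bil:
  assumes "E differentiable (at x)" "u differentiable (at x)" "v differentiable (at x)"
  shows "dird w (\<lambda>y. bil (E y) (u y) (v y)) x
           = bil (dird w E x) (u x) (v x) + bil (E x) (dird w u x) (v x) + bil (E x) (u x) (dird w v x)"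
  by (rule dird_eqI[OF bil_has_derivative[OF assms[THEN dird_works]]])

lemma dird_compose:
  assumes "F differentiable (at x)" "K differentiable (at (F x))"
  shows "dird w (\<lambda>y. K (F y)) x = dird (dird w F x) K (F x)"
  using frechet_derivative_compose[of F x K] assms by (simp add: o_def)

lemma differentiable_compose_at:
  assumes "F differentiable (at x)" "K differentiable (at (F x))"
  shows "(\<lambda>y. K (F y)) differentiable (at x)"
  using differentiable_chain_at[OF assms] by (simp add: o_def)

lemma linear_dird: "F differentiable (at x) \<Longrightarrow> linear (\<lambda>w. dird w F x)"
  by (rule linear_frechet_derivative)

lemma dird_expand:
  assumes "F differentiable (at x)"
  shows "dird (u :: real ^ 'n) F x = (\<Sum>a\<in>UNIV. u $ a *\<^sub>R dird (axis a 1) F x)"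
  by (subst vec_expand[of u])
     (simp only: linear_sum[OF linear_dird[OF assms]] linear_scale[OF linear_dird[OF assms]])

lemma differentiable_cong_open:
  assumes "open U" "x \<in> U" "\<And>y. y \<in> U \<Longrightarrow> F y = G y" "F differentiable (at x)"
  shows "G differentiable (at x)"
  using assms has_derivative_transform_within_open unfolding differentiable_def by blast

section \<open>Componentwise differentiability of vectors and matrices\<close>

lemma differentiable_nth: "F differentiable (at x) \<Longrightarrow> (\<lambda>y. F y $ i) differentiable (at x)"
  unfolding differentiable_def using bounded_linear.has_derivative[OF bounded_linear_vec_nth] by blast

text \<open>The candidate is bounded by the sum of the operator norms of its finitely many
  components, and the remainder tends to zero because each component does.\<close>

lemma has_derivative_vec:
  fixes F :: "'a::real_normed_vector \<Rightarrow> 'b::real_normed_vector ^ 'n::finite"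
  assumes "\<And>i. ((\<lambda>y. F y $ i) has_derivative (\<lambda>d. F' d $ i)) (at x)"
  shows "(F has_derivative F') (at x)"
proof -
  have bl: "bounded_linear F'"
  proof (rule bounded_linear_intro)
    show "F' (a + b) = F' a + F' b" for a b
      using linear_add[OF has_derivative_linear[OF assms]] by (simp add: vec_eq_iff)
    show "F' (r *\<^sub>R a) = r *\<^sub>R F' a" for r a
      using linear_scale[OF has_derivative_linear[OF assms]] by (simp add: vec_eq_iff)
    show "norm (F' a) \<le> norm a * (\<Sum>i\<in>UNIV. onorm (\<lambda>d. F' d $ i))" for a
    proof -
      have "norm (F' a) \<le> (\<Sum>i\<in>UNIV. norm (F' a $ i))"
        unfolding norm_vec_def by (rule L2_set_le_sum) simp
      also have "\<dots> \<le> (\<Sum>i\<in>UNIV. onorm (\<lambda>d. F' d $ i) * norm a)"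
        by (intro sum_mono onorm has_derivative_bounded_linear[OF assms])
      finally show ?thesis by (simp add: sum_distrib_left mult.commute)
    qed
  qed
  show ?thesis
    unfolding has_derivative_def
  proof (intro conjI bl vec_tendstoI)
    fix i
    show "((\<lambda>y. ((F y - F (Lim (at x) (\<lambda>x. x)) - F' (y - Lim (at x) (\<lambda>x. x))) /\<^sub>R
             norm (y - Lim (at x) (\<lambda>x. x))) $ i) \<longlongrightarrow> 0 $ i) (at x)"
      using assms[of i] unfolding has_derivative_def by simp
  qed
qed

lemma differentiable_vec:
  fixes F :: "'a::real_normed_vector \<Rightarrow> 'b::real_normed_vector ^ 'n::finite"
  assumes "\<And>i. (\<lambda>y. F y $ i) differentiable (at x)"
  shows "F differentiable (at x)"
proof -
  have "(F has_derivative (\<lambda>d. \<chi> i. dird d (\<lambda>y. F y $ i) x)) (at x)"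
    by (rule has_derivative_vec) (simp add: dird_works[OF assms])
  then show ?thesis unfolding differentiable_def by blast
qed

lemma differentiable_prod:
  fixes f :: "'i \<Rightarrow> 'a::real_normed_vector \<Rightarrow> real"
  shows "(\<And>i. i \<in> I \<Longrightarrow> f i differentiable (at x)) \<Longrightarrow> (\<lambda>y. \<Prod>i\<in>I. f i y) differentiable (at x)"
  by (induction I rule: infinite_finite_induct) (simp_all add: differentiable_mult)

lemma differentiable_det:
  fixes M :: "'a::real_normed_vector \<Rightarrow> real ^ 'n ^ 'n"
  assumes "\<And>i j. (\<lambda>y. M y $ i $ j) differentiable (at x)"
  shows "(\<lambda>y. det (M y)) differentiable (at x)"
  unfolding det_def
  by (intro differentiable_sum finite_permutations ballI differentiable_mult differentiable_const
      differentiable_prod assms) simp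

lemma invertible_inverse:
  assumes "invertible (E :: real ^ 'n ^ 'n)"
  shows "E ** matrix_inv E = mat 1" "matrix_inv E ** E = mat 1"
proof -
  have "E ** matrix_inv E = mat 1 \<and> matrix_inv E ** E = mat 1"
    unfolding matrix_inv_def using assms unfolding invertible_def by (rule someI_ex)
  then show "E ** matrix_inv E = mat 1" "matrix_inv E ** E = mat 1" by auto
qed

text \<open>Cramer's rule writes each entry of the inverse as a quotient of determinants, which are
  polynomials in the entries. The rule must hold near \<open>x\<close>, hence invertibility on all
  of \<open>U\<close>.\<close>

lemma differentiable_matrix_inv:
  fixes M :: "'a::real_normed_vector \<Rightarrow> real ^ 'n ^ 'n"
  assumes U: "open U" "x \<in> U" and inv: "\<And>y. y \<in> U \<Longrightarrow> invertible (M y)"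
    and M: "M differentiable (at x)"
  shows "(\<lambda>y. matrix_inv (M y)) differentiable (at x)"
proof -
  define C where "C y m l = (\<chi> i j. if j = m then (axis l 1 :: real ^ 'n) $ i else M y $ i $ j)" for y m l
  have cr: "det (C y m l) / det (M y) = matrix_inv (M y) $ m $ l" if "y \<in> U" for y m l
  proof -
    have "M y *v (matrix_inv (M y) *v axis l 1) = axis l 1"
      using invertible_inverse[OF inv[OF that]] by (simp add: matrix_vector_mul_assoc)
    moreover have "det (M y) \<noteq> 0" using inv[OF that] by (simp add: invertible_det_nz)
    ultimately have "matrix_inv (M y) *v axis l 1 = (\<chi> m. det (C y m l) / det (M y))"
      unfolding C_def by (simp add: cramer)
    then have "(matrix_inv (M y) *v axis l 1) $ m = det (C y m l) / det (M y)" by simp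
    then show ?thesis by (simp add: matrix_vector_mult_basis column_def)
  qed
  have entry: "(\<lambda>y. M y $ i $ j) differentiable (at x)" for i j
    by (intro differentiable_nth M)
  show ?thesis
  proof (intro differentiable_vec)
    fix m l
    have d: "det (M x) \<noteq> 0" using inv[OF U(2)] by (simp add: invertible_det_nz)
    have "(\<lambda>y. C y m l $ i $ j) differentiable (at x)" for i j
      unfolding C_def by (cases "j = m") (simp_all add: entry)
    then have "(\<lambda>y. det (C y m l) / det (M y)) differentiable (at x)"
      by (intro differentiable_divide differentiable_det entry d) auto
    then show "(\<lambda>y. matrix_inv (M y) $ m $ l) differentiable (at x)"
      by (rule differentiable_cong_open[OF U cr, rotated])
  qed
qed

definition posdef :: "real ^ 'n ^ 'n \<Rightarrow> bool" where
  "posdef E \<longleftrightarrow> transpose E = E \<and> (\<forall>v. v \<noteq> 0 \<longrightarrow> bil E v v > 0)"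

lemma posdef_sym: "posdef E \<Longrightarrow> bil E u v = bil E v u"
  unfolding posdef_def by (blast intro: bil_sym)

lemma posdef_pos: "posdef E \<Longrightarrow> v \<noteq> 0 \<Longrightarrow> bil E v v > 0"
  unfolding posdef_def by blast

lemma posdef_eqI:
  assumes "posdef E" "\<And>w. bil E u w = bil E v w"
  shows "u = v"
proof (rule ccontr)
  assume "u \<noteq> v"
  then have "bil E (u - v) (u - v) > 0" by (intro posdef_pos[OF assms(1)]) simp
  then show False using assms(2) by (simp add: bil_linear)
qed

lemma posdef_invertible: "posdef E \<Longrightarrow> invertible E"
  unfolding invertible_left_inverse matrix_left_invertible_ker
  by (metis bil_inner inner_zero_right less_irrefl posdef_pos)

section \<open>The Levi-Civita connection in coordinates\<close>

text \<open>The Christoffel symbols become a bilinear map \<open>conn\<close>: with vectors in place of indices the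
  ambient connection can be applied to \<open>df(\<partial>\<^sub>i)\<close>. In \<open>dconn\<close> only the coefficients are differentiated.\<close>

definition christoffel_mat :: "(real ^ 'n::finite \<Rightarrow> real ^ 'n ^ 'n) \<Rightarrow> 'n \<Rightarrow> real ^ 'n \<Rightarrow> real ^ 'n ^ 'n" where
  "christoffel_mat h m y = (\<chi> a b. christoffel h y m a b)"

definition conn :: "(real ^ 'n::finite \<Rightarrow> real ^ 'n ^ 'n) \<Rightarrow> real ^ 'n \<Rightarrow> real ^ 'n \<Rightarrow> real ^ 'n \<Rightarrow> real ^ 'n" where
  "conn h y u v = (\<chi> m. bil (christoffel_mat h m y) u v)"

definition dconn :: "(real ^ 'n::finite \<Rightarrow> real ^ 'n ^ 'n) \<Rightarrow> real ^ 'n \<Rightarrow> real ^ 'n \<Rightarrow> real ^ 'n \<Rightarrow> real ^ 'n \<Rightarrow> real ^ 'n" where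
  "dconn h y w u v = (\<chi> m. bil (dird w (christoffel_mat h m) y) u v)"

text \<open>The commutator of covariant derivatives for constant extensions of the three vectors,
  whose brackets vanish. The order of the arguments and the sign follow
  \<open>riemann_coord\<close>.\<close>

definition curv_op :: "(real ^ 'n::finite \<Rightarrow> real ^ 'n ^ 'n) \<Rightarrow> real ^ 'n \<Rightarrow> real ^ 'n \<Rightarrow> real ^ 'n \<Rightarrow> real ^ 'n \<Rightarrow> real ^ 'n" where
  "curv_op h y u v w = dconn h y u v w - dconn h y v u w + conn h y u (conn h y v w) - conn h y v (conn h y u w)"

lemma conn_linear:
  "conn h y (u + u') v = conn h y u v + conn h y u' v"
  "conn h y u (v + v') = conn h y u v + conn h y u v'"
  "conn h y (r *\<^sub>R u) v = r *\<^sub>R conn h y u v"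
  "conn h y u (r *\<^sub>R v) = r *\<^sub>R conn h y u v"
  by (simp_all add: conn_def vec_eq_iff bil_linear)

lemma dconn_linear:
  "dconn h y w (u + u') v = dconn h y w u v + dconn h y w u' v"
  "dconn h y w u (v + v') = dconn h y w u v + dconn h y w u v'"
  "dconn h y w (r *\<^sub>R u) v = r *\<^sub>R dconn h y w u v"
  "dconn h y w u (r *\<^sub>R v) = r *\<^sub>R dconn h y w u v"
  by (simp_all add: dconn_def vec_eq_iff bil_linear)

lemma conn_axis: "conn h y (axis a 1) (axis b 1) $ m = christoffel h y m a b"
  by (simp add: conn_def bil_axis christoffel_mat_def)

text \<open>A metric on an open set of coordinates, free of charts: the ambient metric in one chart
  and the induced metric on part of another both become instances.\<close>

locale coord_metric =
  fixes V :: "(real ^ 'n::finite) set" and h :: "real ^ 'n \<Rightarrow> real ^ 'n ^ 'n"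
  assumes open_V: "open V"
    and smooth: "smooth_on V h"
    and posdef: "y \<in> V \<Longrightarrow> posdef (h y)"
begin

lemma diff: "y \<in> V \<Longrightarrow> h differentiable (at y)"
  using smooth by (rule smooth_on_differentiable)

lemma sym: "y \<in> V \<Longrightarrow> h y $ a $ b = h y $ b $ a"
  using posdef unfolding posdef_def transpose_def by (auto simp: vec_eq_iff)

lemma dird_sym:
  assumes "y \<in> V"
  shows "dird w h y $ a $ b = dird w h y $ b $ a"
proof -
  have nn: "dird w (\<lambda>y. h y $ a $ b) y = dird w h y $ a $ b" for a b
    by (rule dird_bounded_linear[of "\<lambda>z. z $ a $ b", OF _ diff[OF assms]])
       (intro bounded_linear_compose[OF bounded_linear_vec_nth] bounded_linear_vec_nth)
  have "dird w (\<lambda>y. h y $ a $ b) y = dird w (\<lambda>y. h y $ b $ a) y"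
    by (rule dird_cong_open[OF open_V assms])
       (auto simp: sym intro!: differentiable_nth diff[OF assms])
  then show ?thesis by (simp add: nn)
qed

lemma bil_dird_sym: "y \<in> V \<Longrightarrow> bil (dird w h y) u v = bil (dird w h y) v u"
  by (rule bil_sym) (auto simp: transpose_def vec_eq_iff intro: dird_sym)

lemma bil_dird_expand:
  assumes "y \<in> V"
  shows "bil (dird u h y) v w
    = (\<Sum>a\<in>UNIV. \<Sum>b\<in>UNIV. \<Sum>l\<in>UNIV. dird (axis a 1) h y $ b $ l * u $ a * v $ b * w $ l)"
proof -
  have "bil (dird u h y) v w
      = (\<Sum>b\<in>UNIV. \<Sum>l\<in>UNIV. \<Sum>a\<in>UNIV. dird (axis a 1) h y $ b $ l * u $ a * v $ b * w $ l)"
    by (subst dird_expand[OF diff[OF assms]])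
       (simp add: bil_def sum_distrib_right sum_distrib_left mult_ac)
  also have "\<dots> = (\<Sum>b\<in>UNIV. \<Sum>a\<in>UNIV. \<Sum>l\<in>UNIV. dird (axis a 1) h y $ b $ l * u $ a * v $ b * w $ l)"
    by (rule sum.cong[OF refl], rule sum.swap)
  also have "\<dots> = (\<Sum>a\<in>UNIV. \<Sum>b\<in>UNIV. \<Sum>l\<in>UNIV. dird (axis a 1) h y $ b $ l * u $ a * v $ b * w $ l)"
    by (rule sum.swap)
  finally show ?thesis .
qed

lemma christoffel_eq:
  assumes "y \<in> V"
  shows "christoffel h y m a b = 1/2 * (\<Sum>l\<in>UNIV. matrix_inv (h y) $ m $ l *
     (dird (axis a 1) h y $ b $ l + dird (axis b 1) h y $ a $ l - dird (axis l 1) h y $ a $ b))"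
  unfolding christoffel_def by (simp add: partial_nth_nth[OF diff[OF assms]])

text \<open>Koszul's formula for constant vector fields: lowering the index removes the inverse
  matrix from the Christoffel symbols. Symmetry and metric compatibility of \<open>conn\<close> are
  read off it.\<close>

lemma conn_lower:
  assumes y: "y \<in> V"
  shows "bil (h y) (conn h y u v) w
    = 1/2 * (bil (dird u h y) v w + bil (dird v h y) u w - bil (dird w h y) u v)"
proof -
  let ?D = "\<lambda>a. dird (axis a 1) h y"
  \<comment> \<open>The Christoffel symbols of the first kind contracted with \<open>u\<close> and
    \<open>v\<close>; the inverse metric sends this covector to \<open>conn h y u v\<close>.\<close>
  define X :: "real ^ 'n" where
    "X = (\<chi> l. \<Sum>a\<in>UNIV. \<Sum>b\<in>UNIV. 1/2 * (?D a $ b $ l + ?D b $ a $ l - ?D l $ a $ b) * u $ a * v $ b)"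
  have "conn h y u v $ m = (matrix_inv (h y) *v X) $ m" for m
  proof -
    have "conn h y u v $ m = (\<Sum>a\<in>UNIV. \<Sum>b\<in>UNIV. \<Sum>l\<in>UNIV. matrix_inv (h y) $ m $ l *
        (1/2 * (?D a $ b $ l + ?D b $ a $ l - ?D l $ a $ b) * u $ a * v $ b))"
      by (simp add: conn_def bil_def christoffel_mat_def christoffel_eq[OF y] sum_distrib_left
          sum_distrib_right mult_ac)
    also have "\<dots> = (\<Sum>a\<in>UNIV. \<Sum>l\<in>UNIV. \<Sum>b\<in>UNIV. matrix_inv (h y) $ m $ l *
        (1/2 * (?D a $ b $ l + ?D b $ a $ l - ?D l $ a $ b) * u $ a * v $ b))"
      by (rule sum.cong[OF refl], rule sum.swap)
    also have "\<dots> = (\<Sum>l\<in>UNIV. \<Sum>a\<in>UNIV. \<Sum>b\<in>UNIV. matrix_inv (h y) $ m $ l *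
        (1/2 * (?D a $ b $ l + ?D b $ a $ l - ?D l $ a $ b) * u $ a * v $ b))"
      by (rule sum.swap)
    finally show ?thesis by (simp add: X_def matrix_vector_mult_def sum_distrib_left)
  qed
  then have "h y *v conn h y u v = X"
    using invertible_inverse(1)[OF posdef_invertible[OF posdef[OF y]]]
    by (metis matrix_vector_mul_assoc matrix_vector_mul_lid vec_eq_iff)
  then have "bil (h y) (conn h y u v) w = w \<bullet> X"
    using posdef_sym[OF posdef[OF y], of "conn h y u v" w] by (simp add: bil_inner)
  also have "\<dots> = (\<Sum>l\<in>UNIV. \<Sum>a\<in>UNIV. \<Sum>b\<in>UNIV.
      1/2 * (?D a $ b $ l * u $ a * v $ b * w $ l) + 1/2 * (?D b $ a $ l * v $ b * u $ a * w $ l)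
      - 1/2 * (?D l $ a $ b * w $ l * u $ a * v $ b))"
    by (simp add: inner_vec_def X_def sum_distrib_left algebra_simps)
  also have "\<dots> = (\<Sum>l\<in>UNIV. \<Sum>a\<in>UNIV. \<Sum>b\<in>UNIV. 1/2 * (?D a $ b $ l * u $ a * v $ b * w $ l))
      + (\<Sum>l\<in>UNIV. \<Sum>a\<in>UNIV. \<Sum>b\<in>UNIV. 1/2 * (?D b $ a $ l * v $ b * u $ a * w $ l))
      - (\<Sum>l\<in>UNIV. \<Sum>a\<in>UNIV. \<Sum>b\<in>UNIV. 1/2 * (?D l $ a $ b * w $ l * u $ a * v $ b))"
    by (simp only: sum.distrib sum_subtractf)
  \<comment> \<open>The first two sums are reordered so that the differentiating index stands
    outermost, as in \<open>bil_dird_expand\<close>; the third already has it there.\<close>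
  also have "(\<Sum>l\<in>UNIV. \<Sum>a\<in>UNIV. \<Sum>b\<in>UNIV. 1/2 * (?D a $ b $ l * u $ a * v $ b * w $ l))
      = (\<Sum>a\<in>UNIV. \<Sum>l\<in>UNIV. \<Sum>b\<in>UNIV. 1/2 * (?D a $ b $ l * u $ a * v $ b * w $ l))"
    by (rule sum.swap)
  also have "\<dots> = (\<Sum>a\<in>UNIV. \<Sum>b\<in>UNIV. \<Sum>l\<in>UNIV. 1/2 * (?D a $ b $ l * u $ a * v $ b * w $ l))"
    by (rule sum.cong[OF refl], rule sum.swap)
  also have "(\<Sum>l\<in>UNIV. \<Sum>a\<in>UNIV. \<Sum>b\<in>UNIV. 1/2 * (?D b $ a $ l * v $ b * u $ a * w $ l))
      = (\<Sum>l\<in>UNIV. \<Sum>b\<in>UNIV. \<Sum>a\<in>UNIV. 1/2 * (?D b $ a $ l * v $ b * u $ a * w $ l))"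
    by (rule sum.cong[OF refl], rule sum.swap)
  also have "\<dots> = (\<Sum>b\<in>UNIV. \<Sum>l\<in>UNIV. \<Sum>a\<in>UNIV. 1/2 * (?D b $ a $ l * v $ b * u $ a * w $ l))"
    by (rule sum.swap)
  also have "\<dots> = (\<Sum>b\<in>UNIV. \<Sum>a\<in>UNIV. \<Sum>l\<in>UNIV. 1/2 * (?D b $ a $ l * v $ b * u $ a * w $ l))"
    by (rule sum.cong[OF refl], rule sum.swap)
  finally show ?thesis
    by (simp only: bil_dird_expand[OF y] sum_distrib_left ring_distribs)
qed

lemma conn_sym:
  assumes "y \<in> V"
  shows "conn h y u v = conn h y v u"
proof (rule posdef_eqI[OF posdef[OF assms]])
  fix w
  show "bil (h y) (conn h y u v) w = bil (h y) (conn h y v u) w"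
    unfolding conn_lower[OF assms] using bil_dird_sym[OF assms, of w u v] by simp
qed

lemma metric_compatible:
  assumes "y \<in> V"
  shows "bil (dird w h y) u v = bil (h y) (conn h y w u) v + bil (h y) u (conn h y w v)"
proof -
  have "bil (h y) u (conn h y w v) = bil (h y) (conn h y w v) u"
    by (rule posdef_sym[OF posdef[OF assms]])
  then show ?thesis
    unfolding conn_lower[OF assms]
    using bil_dird_sym[OF assms, of w u v] bil_dird_sym[OF assms, of u w v] bil_dird_sym[OF assms, of v w u]
    by (simp add: field_simps)
qed

lemma christoffel_mat_differentiable:
  assumes y: "y \<in> V"
  shows "christoffel_mat h m differentiable (at y)"
proof (intro differentiable_vec)
  fix a b
  have D: "(\<lambda>y. dird w h y $ i $ j) differentiable (at y)" for w i j
    by (intro differentiable_nth smooth_on_differentiable[OF smooth_on_dird[OF smooth] y])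
  have I: "(\<lambda>y. matrix_inv (h y) $ m $ l) differentiable (at y)" for l
    by (intro differentiable_nth differentiable_matrix_inv[OF open_V y] posdef_invertible posdef diff y)
  have "(\<lambda>y. 1/2 * (\<Sum>l\<in>UNIV. matrix_inv (h y) $ m $ l *
     (dird (axis a 1) h y $ b $ l + dird (axis b 1) h y $ a $ l - dird (axis l 1) h y $ a $ b)))
     differentiable (at y)"
    by (intro differentiable_mult differentiable_const differentiable_sum differentiable_add
        differentiable_diff D I ballI) simp
  then show "(\<lambda>y. christoffel_mat h m y $ a $ b) differentiable (at y)"
    by (rule differentiable_cong_open[OF open_V y, rotated]) (simp add: christoffel_mat_def christoffel_eq)
qed

text \<open>Chain and product rule: moving along \<open>F\<close> changes the coefficients in the
  direction \<open>dird w F x\<close>, which is the \<open>dconn\<close> term, and both vector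
  fields.\<close>

lemma conn_along:
  assumes "F x \<in> V" "F differentiable (at x)" "u differentiable (at x)" "v differentiable (at x)"
  shows "(\<lambda>z. conn h (F z) (u z) (v z)) differentiable (at x)"
    and "dird w (\<lambda>z. conn h (F z) (u z) (v z)) x =
      dconn h (F x) (dird w F x) (u x) (v x) + conn h (F x) (dird w u x) (v x) + conn h (F x) (u x) (dird w v x)"
proof -
  note C = christoffel_mat_differentiable[OF assms(1)]
  have C': "(\<lambda>z. christoffel_mat h m (F z)) differentiable (at x)" for m
    by (rule differentiable_compose_at[OF assms(2) C])
  show d: "(\<lambda>z. conn h (F z) (u z) (v z)) differentiable (at x)"
    by (rule differentiable_vec) (simp add: conn_def bil_differentiable[OF C' assms(3,4)])
  have "dird w (\<lambda>z. conn h (F z) (u z) (v z)) x $ m = dird w (\<lambda>z. conn h (F z) (u z) (v z) $ m) x" for m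
    by (rule dird_bounded_linear[OF bounded_linear_vec_nth d, symmetric])
  then show "dird w (\<lambda>z. conn h (F z) (u z) (v z)) x =
      dconn h (F x) (dird w F x) (u x) (v x) + conn h (F x) (dird w u x) (v x) + conn h (F x) (u x) (dird w v x)"
    by (simp add: vec_eq_iff conn_def dconn_def dird_bil[OF C' assms(3,4)] dird_compose[OF assms(2) C])
qed

text \<open>Each sum of a \<open>dird\<close> and a \<open>conn\<close> term is a covariant
  derivative along \<open>F\<close>, so this is metric compatibility of the pulled-back
  connection.\<close>

lemma dird_metric_along:
  assumes "F x \<in> V" "F differentiable (at x)" "u differentiable (at x)" "v differentiable (at x)"
  shows "dird w (\<lambda>z. bil (h (F z)) (u z) (v z)) x =
      bil (h (F x)) (dird w u x + conn h (F x) (dird w F x) (u x)) (v x)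
      + bil (h (F x)) (u x) (dird w v x + conn h (F x) (dird w F x) (v x))"
proof -
  note d = diff[OF assms(1)]
  have "(\<lambda>z. h (F z)) differentiable (at x)"
    by (rule differentiable_compose_at[OF assms(2) d])
  then show ?thesis
    by (simp add: dird_bil assms dird_compose[OF assms(2) d] metric_compatible[OF assms(1)] bil_linear)
qed

end

section \<open>Curvature along a map\<close>

text \<open>The ambient covariant derivative of \<open>df(v)\<close> in the direction
  \<open>df(u)\<close>, for constant \<open>u\<close> and \<open>v\<close>: the vector form of
  \<open>ambient_hessian\<close>. Its tangential part is kept.\<close>

definition hess :: "(real ^ 'k::finite \<Rightarrow> real ^ 'k ^ 'k) \<Rightarrow> (real ^ 'n::finite \<Rightarrow> real ^ 'k) \<Rightarrow> real ^ 'n \<Rightarrow> real ^ 'n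
    \<Rightarrow> real ^ 'n \<Rightarrow> real ^ 'k" where
  "hess h F u v x = dird u (dird v F) x + conn h (F x) (dird u F x) (dird v F x)"

locale coord_map = coord_metric V h for V :: "(real ^ 'k::finite) set" and h +
  fixes U :: "(real ^ 'n::finite) set" and F :: "real ^ 'n \<Rightarrow> real ^ 'k"
  assumes open_U: "open U"
    and smooth_F: "smooth_on U F"
    and F_into: "x \<in> U \<Longrightarrow> F x \<in> V"
begin

lemma diff_F: "x \<in> U \<Longrightarrow> F differentiable (at x)"
  using smooth_F by (rule smooth_on_differentiable)

lemma smooth_P: "smooth_on U (dird u F)"
  using smooth_F by (rule smooth_on_dird)

lemma diff_P: "x \<in> U \<Longrightarrow> dird u F differentiable (at x)"
  using smooth_P by (rule smooth_on_differentiable)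

lemma diff_PP: "x \<in> U \<Longrightarrow> dird v (dird u F) differentiable (at x)"
  using smooth_P by (intro smooth_on_differentiable[OF smooth_on_dird])

lemma hess_sym: "x \<in> U \<Longrightarrow> hess h F u v x = hess h F v u x"
  unfolding hess_def
  using dird_commute[OF open_U _ smooth_F] conn_sym[OF F_into] by metis

lemma diff_hess: "x \<in> U \<Longrightarrow> hess h F u v differentiable (at x)"
  unfolding hess_def
  by (intro differentiable_add diff_PP conn_along F_into diff_F diff_P)

lemma dird_hess:
  assumes "x \<in> U"
  shows "dird w (hess h F u v) x = dird w (dird u (dird v F)) x
    + dconn h (F x) (dird w F x) (dird u F x) (dird v F x)
    + conn h (F x) (dird w (dird u F) x) (dird v F x) + conn h (F x) (dird u F x) (dird w (dird v F) x)"
proof -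
  note c = conn_along[OF F_into[OF assms] diff_F[OF assms] diff_P[OF assms] diff_P[OF assms]]
  have "dird w (hess h F u v) x = dird w (dird u (dird v F)) x
      + dird w (\<lambda>z. conn h (F z) (dird u F z) (dird v F z)) x"
    unfolding hess_def
    by (rule dird_eqI, intro has_derivative_add dird_works diff_PP assms c(1))
  then show ?thesis by (simp add: c(2))
qed

text \<open>The curvature of the pulled-back connection is the pulled-back curvature: the third
  derivatives of \<open>F\<close> cancel because derivatives commute, and the terms with second
  derivatives cancel in pairs.\<close>

lemma curv_op_along:
  assumes "x \<in> U"
  shows "(dird w (hess h F u v) x + conn h (F x) (dird w F x) (hess h F u v x))
       - (dird u (hess h F w v) x + conn h (F x) (dird u F x) (hess h F w v x))
       = curv_op h (F x) (dird w F x) (dird u F x) (dird v F x)"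
proof -
  have "dird w (dird u (dird v F)) x = dird u (dird w (dird v F)) x"
    by (rule dird_commute[OF open_U assms smooth_P])
  moreover have "dird w (dird u F) x = dird u (dird w F) x"
    by (rule dird_commute[OF open_U assms smooth_F])
  ultimately show ?thesis
    by (simp add: dird_hess[OF assms] curv_op_def hess_def conn_linear)
qed

lemma dird_metric_P:
  assumes "x \<in> U"
  shows "dird w (\<lambda>z. bil (h (F z)) (dird u F z) (dird v F z)) x
    = bil (h (F x)) (hess h F w u x) (dird v F x) + bil (h (F x)) (dird u F x) (hess h F w v x)"
  unfolding hess_def
  by (intro dird_metric_along F_into diff_F diff_P assms)

lemma dird_hess_P:
  assumes "x \<in> U"
  shows "dird w (\<lambda>z. bil (h (F z)) (hess h F u v z) (dird a F z)) x
    = bil (h (F x)) (dird w (hess h F u v) x + conn h (F x) (dird w F x) (hess h F u v x)) (dird a F x)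
      + bil (h (F x)) (hess h F u v x) (hess h F w a x)"
  unfolding hess_def[of h F w a x]
  by (intro dird_metric_along F_into diff_F diff_P diff_hess assms)

text \<open>Koszul's argument along a map: by \<open>dird_metric_P\<close> and the symmetry of
  \<open>hess\<close> the three derivatives add up to twice the left side. On the right
  \<open>h\<close> occurs only in inner products of vectors \<open>df\<close>, that is, through the
  induced metric.\<close>

lemma hess_lower:
  assumes "x \<in> U"
  shows "bil (h (F x)) (hess h F u v x) (dird w F x) = 1/2 *
     (dird u (\<lambda>z. bil (h (F z)) (dird v F z) (dird w F z)) x
      + dird v (\<lambda>z. bil (h (F z)) (dird u F z) (dird w F z)) x
      - dird w (\<lambda>z. bil (h (F z)) (dird u F z) (dird v F z)) x)"
  unfolding dird_metric_P[OF assms]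
  using hess_sym[OF assms, of u v] hess_sym[OF assms, of u w] hess_sym[OF assms, of v w]
  by (simp add: posdef_sym[OF posdef[OF F_into[OF assms]], of "dird v F x"]
        posdef_sym[OF posdef[OF F_into[OF assms]], of "dird u F x"])

text \<open>\<open>curv_op_along\<close> is paired with \<open>dird w F x\<close> and the product
  rule applied, so that the functions left to differentiate are those that \<open>hess_lower\<close>
  expresses by the induced metric.\<close>

lemma curvature_along:
  assumes "x \<in> U"
  shows "bil (h (F x)) (curv_op h (F x) (dird a F x) (dird b F x) (dird v F x)) (dird w F x)
    = dird a (\<lambda>z. bil (h (F z)) (hess h F b v z) (dird w F z)) x
      - dird b (\<lambda>z. bil (h (F z)) (hess h F a v z) (dird w F z)) x
      - bil (h (F x)) (hess h F b v x) (hess h F a w x)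
      + bil (h (F x)) (hess h F a v x) (hess h F b w x)"
  unfolding curv_op_along[OF assms, symmetric] dird_hess_P[OF assms]
  by (simp add: bil_linear)

end

section \<open>Symmetries of the curvature tensor of a metric\<close>

context coord_metric
begin

text \<open>For the identity map, \<open>hess\<close> is \<open>conn\<close> and the ambient
  curvature is that of the metric itself, so the identities along a map specialise to intrinsic
  ones.\<close>

sublocale self: coord_map V h V "\<lambda>y. y"
proof
  have 1: "Ck_on k V (\<lambda>y. c)" for k and c :: "real ^ 'n"
    by (induction k arbitrary: c) auto
  have "Ck_on k V (\<lambda>y. y)" for k
    by (cases k) (use 1 in \<open>auto\<close>)
  then show "smooth_on V (\<lambda>y. y)" unfolding smooth_on_def by blast
qed (use open_V in auto)

lemma hess_id: "hess h (\<lambda>y. y) u v = (\<lambda>y. conn h y u v)"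
  by (auto simp: hess_def fun_eq_iff)

lemma curvature_intrinsic:
  assumes "y \<in> V"
  shows "bil (h y) (curv_op h y a b v) w
    = dird a (\<lambda>z. bil (h z) (conn h z b v) w) y - dird b (\<lambda>z. bil (h z) (conn h z a v) w) y
      - bil (h y) (conn h y b v) (conn h y a w) + bil (h y) (conn h y a v) (conn h y b w)"
  using self.curvature_along[OF assms, of a b v w] by (simp add: hess_id)

text \<open>Differentiating Koszul's formula trades derivatives of the connection for second
  derivatives of the metric, whose symmetry and continuity are available.\<close>

lemma dird_conn_lower:
  assumes "y \<in> V"
  shows "dird a (\<lambda>z. bil (h z) (conn h z b v) w) y
    = 1/2 * (bil (dird a (dird b h) y) v w + bil (dird a (dird v h) y) b w - bil (dird a (dird w h) y) b v)"
proof -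
  have D: "dird u h differentiable (at y)" for u
    by (rule smooth_on_differentiable[OF smooth_on_dird[OF smooth] assms])
  have b: "((\<lambda>z. bil (dird u h z) s t) has_derivative (\<lambda>d. bil (dird d (dird u h) y) s t)) (at y)" for u s t
    using bil_has_derivative[OF dird_works[OF D] has_derivative_const has_derivative_const, of u s t] by simp
  have "((\<lambda>z. 1/2 * (bil (dird b h z) v w + bil (dird v h z) b w - bil (dird w h z) b v)) has_derivative
     (\<lambda>a. 1/2 * (bil (dird a (dird b h) y) v w + bil (dird a (dird v h) y) b w - bil (dird a (dird w h) y) b v))) (at y)"
    by (intro has_derivative_mult_right has_derivative_add has_derivative_diff b)
  then have "((\<lambda>z. bil (h z) (conn h z b v) w) has_derivative
     (\<lambda>a. 1/2 * (bil (dird a (dird b h) y) v w + bil (dird a (dird v h) y) b w - bil (dird a (dird w h) y) b v))) (at y)"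
    by (rule has_derivative_transform_within_open[OF _ open_V assms]) (simp add: conn_lower)
  then show ?thesis by (rule dird_eqI)
qed

lemma bil_dird2_sym:
  assumes "y \<in> V"
  shows "bil (dird a (dird b h) y) u v = bil (dird a (dird b h) y) v u"
proof -
  have D: "dird b h differentiable (at y)"
    by (rule smooth_on_differentiable[OF smooth_on_dird[OF smooth] assms])
  have b: "((\<lambda>z. bil (dird b h z) s t) has_derivative (\<lambda>d. bil (dird d (dird b h) y) s t)) (at y)" for s t
    using bil_has_derivative[OF dird_works[OF D] has_derivative_const has_derivative_const, of s t] by simp
  have "((\<lambda>z. bil (dird b h z) u v) has_derivative (\<lambda>d. bil (dird d (dird b h) y) v u)) (at y)"
    by (rule has_derivative_transform_within_open[OF b open_V assms]) (rule bil_dird_sym)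
  from dird_eqI[OF this] dird_eqI[OF b] show ?thesis by metis
qed

lemma dird2_commute: "y \<in> V \<Longrightarrow> dird a (dird b h) y = dird b (dird a h) y"
  by (rule dird_commute[OF open_V _ smooth])

text \<open>The second derivatives \<open>\<partial>\<^sub>a\<partial>\<^sub>b h(v, w)\<close> cancel; all symmetries of the curvature can be
  read off what is left.\<close>

lemma curvature_formula:
  assumes "y \<in> V"
  shows "bil (h y) (curv_op h y a b v) w
    = 1/2 * (bil (dird a (dird v h) y) b w - bil (dird a (dird w h) y) b v
           - bil (dird b (dird v h) y) a w + bil (dird b (dird w h) y) a v)
      - bil (h y) (conn h y b v) (conn h y a w) + bil (h y) (conn h y a v) (conn h y b w)"
  unfolding curvature_intrinsic[OF assms] dird_conn_lower[OF assms]
  using dird2_commute[OF assms, of a b] by (simp add: field_simps)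

lemma curvature_antisym12:
  assumes "y \<in> V"
  shows "bil (h y) (curv_op h y a b v) w = - bil (h y) (curv_op h y b a v) w"
  unfolding curvature_formula[OF assms] by (simp add: field_simps)

lemma curvature_antisym34:
  assumes "y \<in> V"
  shows "bil (h y) (curv_op h y a b v) w = - bil (h y) (curv_op h y a b w) v"
  unfolding curvature_formula[OF assms]
    posdef_sym[OF posdef[OF assms], of "conn h y b w"] posdef_sym[OF posdef[OF assms], of "conn h y a w"]
  by (simp add: field_simps)

lemma curvature_pair_sym:
  assumes "y \<in> V"
  shows "bil (h y) (curv_op h y a b v) w = bil (h y) (curv_op h y v w a) b"
  unfolding curvature_formula[OF assms]
    conn_sym[OF assms, of v b] conn_sym[OF assms, of v a] conn_sym[OF assms, of w a] conn_sym[OF assms, of w b]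
    bil_dird2_sym[OF assms, of _ _ w b] bil_dird2_sym[OF assms, of _ _ w a]
    bil_dird2_sym[OF assms, of _ _ v b] bil_dird2_sym[OF assms, of _ _ v a]
    dird2_commute[OF assms, of v a] dird2_commute[OF assms, of v b]
    dird2_commute[OF assms, of w a] dird2_commute[OF assms, of w b]
    posdef_sym[OF posdef[OF assms], of "conn h y a w"]
  by (simp add: field_simps)

lemma curvature_bianchi:
  assumes "y \<in> V"
  shows "bil (h y) (curv_op h y a b v) w + bil (h y) (curv_op h y b v a) w
    + bil (h y) (curv_op h y v a b) w = 0"
  unfolding curvature_formula[OF assms]
    conn_sym[OF assms, of v b] conn_sym[OF assms, of v a] conn_sym[OF assms, of b a]
    bil_dird2_sym[OF assms, of _ _ v b] bil_dird2_sym[OF assms, of _ _ v a] bil_dird2_sym[OF assms, of _ _ b a]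
    dird2_commute[OF assms, of v b] dird2_commute[OF assms, of v a] dird2_commute[OF assms, of b a]
  by (simp add: field_simps)

end

section \<open>Constant curvature\<close>

lemma linear_expand_axis:
  fixes f :: "real ^ 'n \<Rightarrow> real"
  assumes "linear f"
  shows "f u = (\<Sum>i\<in>UNIV. f (axis i 1) * u $ i)"
  by (subst vec_expand[of u]) (simp only: linear_sum[OF assms] linear_scale[OF assms] real_scaleR_def mult.commute)

lemma quadrilinear_expand_axis:
  fixes Q :: "real ^ 'n \<Rightarrow> real ^ 'n \<Rightarrow> real ^ 'n \<Rightarrow> real ^ 'n \<Rightarrow> real"
  assumes "\<And>b v w. linear (\<lambda>a. Q a b v w)" "\<And>a v w. linear (\<lambda>b. Q a b v w)"
    "\<And>a b w. linear (\<lambda>v. Q a b v w)" "\<And>a b v. linear (Q a b v)"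
  shows "Q a b v w = (\<Sum>h\<in>UNIV. \<Sum>i\<in>UNIV. \<Sum>j\<in>UNIV. \<Sum>k\<in>UNIV.
    Q (axis h 1) (axis i 1) (axis j 1) (axis k 1) * a $ h * b $ i * v $ j * w $ k)"
  by (subst linear_expand_axis[OF assms(1)], subst linear_expand_axis[OF assms(2)],
      subst linear_expand_axis[OF assms(3)], subst linear_expand_axis[OF assms(4)])
     (simp add: sum_distrib_right sum_distrib_left mult_ac)

text \<open>Two polarizations: \<open>zero\<close> at \<open>b + v\<close> makes
  \<open>Q a b v a\<close> vanish, and this at \<open>a + w\<close> makes \<open>Q\<close> change
  sign when its outer arguments are exchanged. With \<open>anti12\<close> and \<open>anti34\<close>
  this leaves \<open>Q\<close> invariant under the cyclic permutation of its first three arguments,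
  which is even, and \<open>bianchi\<close> becomes \<open>3 Q = 0\<close>.\<close>

lemma curvature_like_eq_zero:
  fixes Q :: "'a::ab_group_add \<Rightarrow> 'a \<Rightarrow> 'a \<Rightarrow> 'a \<Rightarrow> real"
  assumes add1: "\<And>a a' b v w. Q (a + a') b v w = Q a b v w + Q a' b v w"
    and add2: "\<And>a b b' v w. Q a (b + b') v w = Q a b v w + Q a b' v w"
    and anti12: "\<And>a b v w. Q a b v w = - Q b a v w"
    and anti34: "\<And>a b v w. Q a b v w = - Q a b w v"
    and pair: "\<And>a b v w. Q a b v w = Q v w a b"
    and bianchi: "\<And>a b v w. Q a b v w + Q b v a w + Q v a b w = 0"
    and zero: "\<And>a b. Q a b b a = 0"
  shows "Q a b v w = 0"
proof -
  have add3: "Q a b (v + v') w = Q a b v w + Q a b v' w" for a b v v' w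
    using add1[of v v' w a b] by (simp add: pair[symmetric])
  have add4: "Q a b v (w + w') = Q a b v w + Q a b v w'" for a b v w w'
    using add2[of v w w' a b] by (simp add: pair[symmetric])
  have z3: "Q a b v a = 0" for a b v
  proof -
    have "Q a b v a + Q a v b a = 0"
      using zero[of a "b + v"] zero[of a b] zero[of a v] by (simp add: add2 add3)
    moreover have "Q a v b a = Q a b v a"
      using pair[of a v b a] anti12[of b a a v] anti34[of a b a v] by simp
    ultimately show ?thesis by simp
  qed
  have anti14: "Q a b v w = - Q w b v a" for a b v w
    using z3[of "a + w" b v] z3[of a b v] z3[of w b v] by (simp add: add1 add4)
  have "Q b v a w = Q a b v w"
    using anti12[of b v a w] anti14[of v b a w] anti34[of w b a v] anti14[of w b v a] by simp
  moreover have "Q v a b w = Q b v a w"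
    using anti12[of v a b w] anti14[of a v b w] anti34[of w v b a] anti14[of w v a b] by simp
  ultimately show ?thesis using bianchi[of a b v w] by simp
qed

text \<open>The strict Cauchy-Schwarz inequality; it makes the denominator of the sectional
  curvature nonzero.\<close>

lemma posdef_gram_pos:
  assumes E: "posdef E" and ind: "u \<noteq> v" "independent {u, v}"
  shows "bil E u u * bil E v v - (bil E u v)\<^sup>2 > 0"
proof -
  have "u \<noteq> 0" using ind(2) dependent_zero by blast
  then have uu: "bil E u u > 0" by (rule posdef_pos[OF E])
  \<comment> \<open>The part of \<open>v\<close> orthogonal to \<open>u\<close>, multiplied by
    \<open>bil E u u\<close> to avoid a division.\<close>
  define w where "w = bil E u u *\<^sub>R v - bil E u v *\<^sub>R u"
  have "w \<noteq> 0"
  proof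
    assume "w = 0"
    then have e: "bil E u u *\<^sub>R v = bil E u v *\<^sub>R u" unfolding w_def by simp
    have "v = inverse (bil E u u) *\<^sub>R (bil E u u *\<^sub>R v)" using uu by simp
    then have "v = (inverse (bil E u u) * bil E u v) *\<^sub>R u" unfolding e by simp
    then have "v \<in> span {u}" by (metis span_base span_scale singletonI)
    then show False using ind by (simp add: independent_insert insert_commute[of u])
  qed
  then have "bil E w w > 0" by (rule posdef_pos[OF E])
  also have "bil E w w = bil E u u * (bil E u u * bil E v v - (bil E u v)\<^sup>2)"
    unfolding w_def using posdef_sym[OF E, of v u] by (simp add: bil_linear algebra_simps power2_eq_square)
  finally show ?thesis using uu by (simp add: zero_less_mult_iff)
qed

section \<open>From sectional curvatures to the full curvature tensor\<close>

context coord_metric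
begin

lemma linear_dconn: "y \<in> V \<Longrightarrow> linear (\<lambda>w. dconn h y w u v)"
  unfolding dconn_def
  by (intro linearI)
     (simp_all add: vec_eq_iff linear_add[OF linear_dird[OF christoffel_mat_differentiable]]
      linear_scale[OF linear_dird[OF christoffel_mat_differentiable]] bil_add_form bil_scaleR_form)

lemma linear_curvature:
  assumes "y \<in> V"
  shows "linear (\<lambda>a. bil (h y) (curv_op h y a b v) w)" "linear (\<lambda>b. bil (h y) (curv_op h y a b v) w)"
    "linear (\<lambda>v. bil (h y) (curv_op h y a b v) w)" "linear (bil (h y) (curv_op h y a b v))"
  by (intro linearI; simp add: curv_op_def bil_linear conn_linear dconn_linear
      linear_add[OF linear_dconn[OF assms]] linear_scale[OF linear_dconn[OF assms]] algebra_simps)+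

text \<open>Joins index notation to the vector form: on axis vectors \<open>dconn\<close> is a
  partial derivative of a Christoffel symbol, and the nested \<open>conn\<close> is a sum of
  products of two of them.\<close>

lemma riemann_coord_eq:
  assumes "y \<in> V"
  shows "riemann_coord h y a b i j = bil (h y) (curv_op h y (axis a 1) (axis b 1) (axis i 1)) (axis j 1)"
proof -
  have right: "bil E u (axis j 1) = (\<Sum>m\<in>UNIV. E $ m $ j * u $ m)" for E and u :: "real ^ 'n"
    by (simp add: bil_inner inner_vec_def matrix_vector_mult_basis column_def mult.commute)
  have left: "bil E (axis j 1) u = (\<Sum>m\<in>UNIV. E $ j $ m * u $ m)" for E j and u :: "real ^ 'n"
    by (simp add: bil_inner inner_axis' matrix_vector_mult_def)
  have d: "dconn h y (axis a 1) (axis b 1) (axis i 1) $ m = partial a (\<lambda>y. christoffel h y m b i) y" for a b i m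
    using partial_nth_nth[OF christoffel_mat_differentiable[OF assms], of a m b i]
    by (simp add: dconn_def bil_axis) (simp add: christoffel_mat_def)
  show ?thesis
    unfolding riemann_coord_def right
  proof (intro sum.cong refl arg_cong2[of _ _ _ _ "(*)"])
    fix m
    have c: "conn h y (axis a 1) (conn h y (axis b 1) (axis i 1)) $ m
        = (\<Sum>l\<in>UNIV. christoffel h y l b i * christoffel h y m a l)" for a b
      by (simp add: conn_def[of h y "axis a 1"] left conn_axis christoffel_mat_def mult.commute)
    show "partial a (\<lambda>y. christoffel h y m b i) y - partial b (\<lambda>y. christoffel h y m a i) y
       + (\<Sum>l\<in>UNIV. christoffel h y l b i * christoffel h y m a l - christoffel h y l a i * christoffel h y m b l)
       = curv_op h y (axis a 1) (axis b 1) (axis i 1) $ m"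
      by (simp add: curv_op_def d c sum_subtractf)
  qed
qed

lemma curvature_expand:
  assumes "y \<in> V"
  shows "bil (h y) (curv_op h y a b v) w = (\<Sum>l\<in>UNIV. \<Sum>i\<in>UNIV. \<Sum>j\<in>UNIV. \<Sum>k\<in>UNIV.
    riemann_coord h y l i j k * a $ l * b $ i * v $ j * w $ k)"
  unfolding riemann_coord_eq[OF assms]
  by (rule quadrilinear_expand_axis[of "\<lambda>a b v. bil (h y) (curv_op h y a b v)"])
     (intro linear_curvature[OF assms])+

text \<open>The difference \<open>Q\<close> from the constant curvature model has all symmetries
  required by \<open>curvature_like_eq_zero\<close>, and \<open>sec\<close> makes it vanish on
  planes.\<close>

lemma constant_curvature_tensor:
  assumes y: "y \<in> V"
    and sec: "\<And>u v. u \<noteq> v \<Longrightarrow> independent {u, v} \<Longrightarrow>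
       (\<Sum>l\<in>UNIV. \<Sum>i\<in>UNIV. \<Sum>j\<in>UNIV. \<Sum>k\<in>UNIV. riemann_coord h y l i j k * u $ l * v $ i * v $ j * u $ k)
         / (bil (h y) u u * bil (h y) v v - (bil (h y) u v)\<^sup>2) = c"
  shows "bil (h y) (curv_op h y a b v) w
    = c * (bil (h y) a w * bil (h y) b v - bil (h y) a v * bil (h y) b w)"
proof -
  let ?R = "\<lambda>a b v w. bil (h y) (curv_op h y a b v) w"
  let ?G = "\<lambda>a b v w. bil (h y) a w * bil (h y) b v - bil (h y) a v * bil (h y) b w"
  note s = posdef_sym[OF posdef[OF y]]
  define Q where "Q a b v w = ?R a b v w - c * ?G a b v w" for a b v w
  have "Q a b v w = 0"
  proof (rule curvature_like_eq_zero[of Q])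
    fix a a' b b' v w
    show "Q (a + a') b v w = Q a b v w + Q a' b v w"
      using linear_add[OF linear_curvature(1)[OF y]] by (simp add: Q_def bil_linear algebra_simps)
    show "Q a (b + b') v w = Q a b v w + Q a b' v w"
      using linear_add[OF linear_curvature(2)[OF y]] by (simp add: Q_def bil_linear algebra_simps)
    show "Q a b v w = - Q b a v w"
      using curvature_antisym12[OF y, of a b v w] by (simp add: Q_def algebra_simps)
    show "Q a b v w = - Q a b w v"
      using curvature_antisym34[OF y, of a b v w] by (simp add: Q_def algebra_simps)
    show "Q a b v w = Q v w a b"
      using curvature_pair_sym[OF y, of a b v w] s[of v b] s[of w a] s[of v a] s[of w b]
      by (simp add: Q_def algebra_simps)
    show "Q a b v w + Q b v a w + Q v a b w = 0"
      using curvature_bianchi[OF y, of a b v w] s[of b a] s[of v a] s[of v b]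
      by (simp add: Q_def algebra_simps)
    show "Q a b b a = 0"
    proof (cases "a \<noteq> b \<and> independent {a, b}")
      case True
      then have "?R a b b a / (bil (h y) a a * bil (h y) b b - (bil (h y) a b)\<^sup>2) = c"
        using sec[of a b] unfolding curvature_expand[OF y] by blast
      then show ?thesis
        using True posdef_gram_pos[OF posdef[OF y], of a b] s[of b a]
        by (simp add: Q_def divide_eq_eq power2_eq_square)
    next
      \<comment> \<open>A dependent pair spans no plane, so \<open>sec\<close> says nothing; both
        tensors vanish there by linearity and antisymmetry.\<close>
      case False
      have self: "?R u u v w = 0" for u v w
        using curvature_antisym12[OF y, of u u v w] by simp
      consider "a = 0" | r where "b = r *\<^sub>R a"
      proof (cases "a = 0")
        case a: False
        then have "b \<in> span {a}"
          using False by (cases "a = b") (auto simp: independent_insert insert_commute[of a] span_base split: if_splits)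
        then show ?thesis using that(2) by (auto simp: span_singleton)
      qed
      then show ?thesis
      proof cases
        case 1
        then show ?thesis using linear_0[OF linear_curvature(1)[OF y]] by (simp add: Q_def)
      next
        case 2
        then show ?thesis using linear_scale[OF linear_curvature(2)[OF y], of a r a]
          by (simp add: Q_def self bil_linear)
      qed
    qed
  qed
  then show ?thesis by (simp add: Q_def)
qed

end

section \<open>The Gauss equation\<close>

locale isometric_coord_map = coord_map V h U F + g: coord_metric U g
  for V and h :: "real ^ 'k::finite \<Rightarrow> real ^ 'k ^ 'k" and U and F :: "real ^ 'n::finite \<Rightarrow> real ^ 'k"
    and g :: "real ^ 'n \<Rightarrow> real ^ 'n ^ 'n" +
  assumes isometric: "x \<in> U \<Longrightarrow> bil (g x) u v = bil (h (F x)) (dird u F x) (dird v F x)"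
begin

text \<open>\<open>hess_lower\<close> and \<open>conn_lower\<close> are the same Koszul expression,
  evaluated on metrics that agree near \<open>x\<close> by isometry.\<close>

lemma hess_tangential:
  assumes "x \<in> U"
  shows "bil (h (F x)) (hess h F u v x) (dird w F x) = bil (g x) (conn g x u v) w"
proof -
  have D: "dird u (\<lambda>z. bil (h (F z)) (dird v F z) (dird w F z)) x = bil (dird u g x) v w" for u v w
  proof -
    have "((\<lambda>z. bil (g z) v w) has_derivative (\<lambda>d. bil (dird d g x) v w)) (at x)"
      using bil_has_derivative[OF dird_works[OF g.diff[OF assms]] has_derivative_const has_derivative_const, of v w]
      by simp
    then have "((\<lambda>z. bil (h (F z)) (dird v F z) (dird w F z)) has_derivative (\<lambda>d. bil (dird d g x) v w)) (at x)"
      by (rule has_derivative_transform_within_open[OF _ open_U assms isometric])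
    then show ?thesis by (rule dird_eqI)
  qed
  show ?thesis unfolding hess_lower[OF assms] D g.conn_lower[OF assms] ..
qed

text \<open>By \<open>hess_tangential\<close> the functions differentiated in
  \<open>curvature_along\<close> and in \<open>curvature_intrinsic\<close> agree near
  \<open>x\<close>, so these terms cancel. Each bracket is the inner product of two normal parts, in
  any codimension.\<close>

lemma gauss_general:
  assumes "x \<in> U"
  shows "bil (g x) (curv_op g x a b v) w
    = bil (h (F x)) (curv_op h (F x) (dird a F x) (dird b F x) (dird v F x)) (dird w F x)
      + (bil (h (F x)) (hess h F b v x) (hess h F a w x) - bil (g x) (conn g x b v) (conn g x a w))
      - (bil (h (F x)) (hess h F a v x) (hess h F b w x) - bil (g x) (conn g x a v) (conn g x b w))"
proof -
  have diff: "(\<lambda>z. bil (h (F z)) (hess h F b v z) (dird w F z)) differentiable (at x)" for b v w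
    by (intro bil_differentiable diff_hess diff_P assms
        differentiable_compose_at[OF diff_F[OF assms] diff] F_into)
  have "dird a (\<lambda>z. bil (h (F z)) (hess h F b v z) (dird w F z)) x = dird a (\<lambda>z. bil (g z) (conn g z b v) w) x" for a b v w
    by (rule dird_cong_open[OF open_U assms hess_tangential diff])
  then show ?thesis
    unfolding g.curvature_intrinsic[OF assms] curvature_along[OF assms] by simp
qed

text \<open>In codimension one the image of \<open>dF\<close> and \<open>\<nu>\<close> span the
  ambient space, so it is enough to test on these: \<open>hess_tangential\<close> settles the
  tangential directions, \<open>unit\<close> and \<open>normal\<close> the remaining one.\<close>

lemma hess_hypersurface:
  assumes x: "x \<in> U" and codim: "CARD('k) = CARD('n) + 1"
    and inj: "inj (\<lambda>u. dird u F x)"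
    and unit: "bil (h (F x)) \<nu> \<nu> = 1"
    and normal: "\<And>u. bil (h (F x)) (dird u F x) \<nu> = 0"
  shows "hess h F u v x = dird (conn g x u v) F x + bil (h (F x)) (hess h F u v x) \<nu> *\<^sub>R \<nu>"
proof -
  note s = posdef_sym[OF posdef[OF F_into[OF x]]]
  let ?T = "range (\<lambda>u. dird u F x)"
  have lin: "linear (\<lambda>u. dird u F x)" by (rule linear_dird[OF diff_F[OF x]])
  have subT: "subspace ?T" by (rule linear_subspace_image[OF lin subspace_UNIV])
  have dimT: "dim ?T = CARD('n)"
    using dim_image_eq[OF lin, of UNIV] inj by simp
  \<comment> \<open>A tangential \<open>\<nu>\<close> would be orthogonal to itself, against
    \<open>unit\<close>.\<close>
  have "\<nu> \<notin> ?T"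
  proof
    assume "\<nu> \<in> ?T"
    then obtain u where "\<nu> = dird u F x" by auto
    then show False using normal[of u] unit by simp
  qed
  then have "\<nu> \<notin> span ?T" using subT by (simp add: span_eq_iff[THEN iffD2])
  then have "dim (insert \<nu> ?T) = CARD('k)" by (simp add: dim_insert dimT codim)
  then have full: "span (insert \<nu> ?T) = UNIV"
    using dim_eq_full[of "insert \<nu> ?T"] by simp
  show ?thesis
  proof (rule posdef_eqI[OF posdef[OF F_into[OF x]]])
    fix w
    obtain r where "w - r *\<^sub>R \<nu> \<in> span ?T"
      using full span_breakdown_eq[of w \<nu> ?T] by auto
    then obtain t where "w - r *\<^sub>R \<nu> = dird t F x"
      using subT by (auto simp: span_eq_iff[THEN iffD2])
    then have w: "w = dird t F x + r *\<^sub>R \<nu>" by (simp add: algebra_simps)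
    show "bil (h (F x)) (hess h F u v x) w
      = bil (h (F x)) (dird (conn g x u v) F x + bil (h (F x)) (hess h F u v x) \<nu> *\<^sub>R \<nu>) w"
      unfolding w using normal[of t] s[of \<nu> "dird t F x"]
      by (simp add: bil_linear hess_tangential[OF x] isometric[OF x] normal unit)
  qed
qed

text \<open>Here \<open>\<nu>\<close> is a single vector at \<open>x\<close>, not a field: the
  normal parts in \<open>gauss_general\<close> are multiples of it.\<close>

theorem gauss_hypersurface:
  assumes x: "x \<in> U" and codim: "CARD('k) = CARD('n) + 1"
    and inj: "inj (\<lambda>u. dird u F x)"
    and unit: "bil (h (F x)) \<nu> \<nu> = 1"
    and normal: "\<And>u. bil (h (F x)) (dird u F x) \<nu> = 0"
  shows "bil (g x) (curv_op g x a b v) w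
    = bil (h (F x)) (curv_op h (F x) (dird a F x) (dird b F x) (dird v F x)) (dird w F x)
      + bil (h (F x)) (hess h F b v x) \<nu> * bil (h (F x)) (hess h F a w x) \<nu>
      - bil (h (F x)) (hess h F a v x) \<nu> * bil (h (F x)) (hess h F b w x) \<nu>"
proof -
  note s = posdef_sym[OF posdef[OF F_into[OF x]]]
  have n: "bil (h (F x)) \<nu> (dird u F x) = 0" for u using s normal by metis
  have "bil (h (F x)) (hess h F b v x) (hess h F a w x)
      = bil (g x) (conn g x b v) (conn g x a w)
        + bil (h (F x)) (hess h F b v x) \<nu> * bil (h (F x)) (hess h F a w x) \<nu>" for a b v w
  proof -
    have "bil (h (F x)) (hess h F b v x) (hess h F a w x)
      = bil (h (F x)) (dird (conn g x b v) F x + bil (h (F x)) (hess h F b v x) \<nu> *\<^sub>R \<nu>)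
          (dird (conn g x a w) F x + bil (h (F x)) (hess h F a w x) \<nu> *\<^sub>R \<nu>)"
      using hess_hypersurface[OF assms] by metis
    also have "\<dots> = bil (g x) (conn g x b v) (conn g x a w)
        + bil (h (F x)) (hess h F b v x) \<nu> * bil (h (F x)) (hess h F a w x) \<nu>"
      by (simp add: bil_linear normal n unit isometric[OF x])
    finally show ?thesis .
  qed
  then show ?thesis unfolding gauss_general[OF x] by simp
qed

end

section \<open>Simultaneous diagonalization of the two fundamental forms\<close>

lemma posdef_mult_inverse:
  assumes "posdef g"
  shows "g *v (matrix_inv g *v u) = u" "matrix_inv g *v (g *v u) = u"
  using invertible_inverse[OF posdef_invertible[OF assms]] by (simp_all add: matrix_vector_mul_assoc)

lemma posdef_mult_eq_iff: "posdef g \<Longrightarrow> g *v u = g *v v \<longleftrightarrow> u = v"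
  by (metis posdef_mult_inverse(2))

lemma bil_shape:
  assumes g: "posdef g" and H: "transpose H = H"
  shows "bil g (matrix_inv g *v (H *v u)) v = bil H u v"
  unfolding posdef_sym[OF g, of _ v] bil_sym[OF H, of u]
  by (simp add: bil_inner posdef_mult_inverse[OF g])

lemma shape_operator_eq:
  assumes "posdef g" "transpose H = H"
  shows "shape_operator g H u = matrix_inv g *v (H *v u)"
  unfolding shape_operator_def
proof (rule the_equality)
  show "\<forall>v. bil g (matrix_inv g *v (H *v u)) v = bil H u v"
    using bil_shape[OF assms] by blast
next
  fix w assume "\<forall>v. bil g w v = bil H u v"
  then show "w = matrix_inv g *v (H *v u)"
    by (intro posdef_eqI[OF assms(1)]) (simp add: bil_shape[OF assms])
qed

text \<open>Applying \<open>g\<close> turns the eigenvalue equation into one for a symmetric pencil,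
  in which no inverse matrix is left.\<close>

lemma eigenspace_shape_operator:
  assumes "posdef g" "transpose H = H"
  shows "eigenspace (shape_operator g H) e = {u. H *v u = e *\<^sub>R (g *v u)}"
proof -
  have "matrix_inv g *v (H *v u) = e *\<^sub>R u \<longleftrightarrow> H *v u = e *\<^sub>R (g *v u)" for u
    using posdef_mult_eq_iff[OF assms(1), of "matrix_inv g *v (H *v u)" "e *\<^sub>R u"]
    by (simp add: posdef_mult_inverse[OF assms(1)] matrix_vector_mult_scaleR)
  then show ?thesis by (simp add: eigenspace_def shape_operator_eq[OF assms])
qed

lemma continuous_on_bil:
  assumes "continuous_on S E" "continuous_on S u" "continuous_on S v"
  shows "continuous_on S (\<lambda>y. bil (E y) (u y) (v y))"
  unfolding bil_def by (intro continuous_intros assms)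

text \<open>If \<open>Q v w\<close> were nonzero, the linear term would dominate for small
  \<open>t\<close> of the opposite sign and make the form negative.\<close>

lemma form_zero_orthogonal:
  assumes sym: "\<And>u v. Q u v = Q v u"
    and nonneg: "\<And>t. Q (v + t *\<^sub>R w) (v + t *\<^sub>R w) \<ge> 0"
    and lin: "\<And>t. Q (v + t *\<^sub>R w) (v + t *\<^sub>R w) = Q v v + 2 * t * Q v w + t\<^sup>2 * Q w w"
    and zero: "Q v v = (0::real)"
  shows "Q (v::'a::real_vector) w = 0"
proof (rule ccontr)
  assume ne: "Q v w \<noteq> 0"
  define k where "k = \<bar>Q w w\<bar> + 1"
  have k: "k > 0" "Q w w < k" unfolding k_def by auto
  \<comment> \<open>Since \<open>k\<close> is positive and exceeds \<open>Q w w\<close>, the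
    quadratic term costs less than the linear term gains.\<close>
  define t where "t = - Q v w / k"
  have "2 * t * Q v w + t\<^sup>2 * Q w w = (Q v w)\<^sup>2 / k\<^sup>2 * (Q w w - 2 * k)"
    unfolding t_def using k by (simp add: field_simps power2_eq_square)
  also have "\<dots> < 0"
    using ne k by (intro mult_pos_neg) auto
  finally show False using nonneg[of t] unfolding lin zero by simp
qed

text \<open>The Rayleigh quotient attains its maximum at an eigenvector.\<close>

lemma relative_eigenvector_exists:
  fixes W :: "(real ^ 'n) set"
  assumes g: "posdef g" and H: "transpose H = H"
    and W: "subspace W" "W \<noteq> {0}"
    and inv: "\<And>u. u \<in> W \<Longrightarrow> matrix_inv g *v (H *v u) \<in> W"
  shows "\<exists>v\<in>W. v \<noteq> 0 \<and> (\<exists>e. H *v v = e *\<^sub>R (g *v v))"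
proof -
  let ?K = "W \<inter> sphere 0 1"
  define q where "q v = bil H v v / bil g v v" for v
  have pos: "bil g v v > 0" if "v \<noteq> 0" for v using posdef_pos[OF g that] .
  obtain w0 where w0: "w0 \<in> W" "w0 \<noteq> 0" using W subspace_0 by blast
  have "compact ?K" using closed_subspace[OF W(1)] by (intro closed_Int_compact) auto
  moreover have "(1 / norm w0) *\<^sub>R w0 \<in> ?K" using w0 W(1) by (auto simp: subspace_scale)
  moreover have "continuous_on ?K q"
    unfolding q_def
    by (intro continuous_on_divide continuous_on_bil continuous_on_const continuous_on_id)
       (metis Int_iff dist_0_norm less_irrefl mem_sphere norm_zero pos zero_neq_one)
  ultimately have "\<exists>v\<in>?K. \<forall>w\<in>?K. q w \<le> q v"
    by (intro continuous_attains_sup) auto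
  then obtain v where v: "v \<in> ?K" "\<And>w. w \<in> ?K \<Longrightarrow> q w \<le> q v" by blast
  define m where "m = q v"
  have v0: "v \<noteq> 0" "v \<in> W" using v(1) by auto
  \<comment> \<open>Nonnegative on \<open>W\<close> and zero at the maximizer \<open>v\<close>, so
    \<open>v\<close> is \<open>Q\<close>-orthogonal to \<open>W\<close>; this replaces
    differentiating the quotient.\<close>
  define Q where "Q u w = m * bil g u w - bil H u w" for u w
  have nonneg: "Q w w \<ge> 0" if w: "w \<in> W" for w
  proof (cases "w = 0")
    case False
    have "(1 / norm w) *\<^sub>R w \<in> ?K" using w W(1) False by (auto simp: subspace_scale)
    from v(2)[OF this] have "q w \<le> m"
      using False by (simp add: q_def m_def bil_linear)
    then show ?thesis using pos[OF False] by (simp add: q_def Q_def divide_le_eq)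
  qed (simp add: Q_def)
  have Qzero: "Q v v = 0" using pos[OF v0(1)] by (simp add: Q_def m_def q_def)
  have orth: "Q v w = 0" if "w \<in> W" for w
  proof (rule form_zero_orthogonal[of Q])
    show "Q u w = Q w u" for u w unfolding Q_def using posdef_sym[OF g, of u w] bil_sym[OF H, of u w] by simp
    show "Q (v + t *\<^sub>R w) (v + t *\<^sub>R w) \<ge> 0" for t
      by (intro nonneg subspace_add subspace_scale W that v0)
    show "Q (v + t *\<^sub>R w) (v + t *\<^sub>R w) = Q v v + 2 * t * Q v w + t\<^sup>2 * Q w w" for t
      unfolding Q_def using posdef_sym[OF g, of v w] bil_sym[OF H, of v w]
      by (simp add: bil_linear algebra_simps power2_eq_square)
  qed (rule Qzero)
  \<comment> \<open>Testing the orthogonality on this \<open>w\<close> gives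
    \<open>bil g w w = Q v w = 0\<close>.\<close>
  define w where "w = m *\<^sub>R v - matrix_inv g *v (H *v v)"
  have "w \<in> W" unfolding w_def by (intro subspace_diff subspace_scale W v0 inv)
  then have "bil g w w = 0"
    using orth[of w] by (simp add: w_def Q_def bil_diff_left[of g "m *\<^sub>R v"] bil_scaleR_left bil_shape[OF g H])
  then have "w = 0" using pos[of w] by fastforce
  then have "g *v (matrix_inv g *v (H *v v)) = g *v (m *\<^sub>R v)" unfolding w_def by simp
  then have "H *v v = m *\<^sub>R (g *v v)"
    by (simp add: posdef_mult_inverse[OF g] matrix_vector_mult_scaleR)
  then show ?thesis using v0 by blast
qed

text \<open>The spectral theorem for the pencil: the \<open>g\<close>-orthogonal complement
  \<open>W\<close> of all eigenvectors is invariant, and if nonzero it would contain an eigenvector,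
  which would be orthogonal to itself.\<close>

lemma span_relative_eigenvectors:
  fixes g H :: "real ^ 'n ^ 'n"
  assumes g: "posdef g" and H: "transpose H = H"
  shows "span {v. \<exists>e. H *v v = e *\<^sub>R (g *v v)} = UNIV"
proof (rule ccontr)
  let ?B = "{v. \<exists>e. H *v v = e *\<^sub>R (g *v v)}"
  let ?L = "\<lambda>u. matrix_inv g *v (H *v u)"
  assume "span ?B \<noteq> UNIV"
  then obtain z where z: "z \<noteq> 0" "\<And>x. x \<in> span ?B \<Longrightarrow> z \<bullet> x = 0"
    using span_not_UNIV_orthogonal by blast
  define W where "W = {v. \<forall>w\<in>span ?B. bil g w v = 0}"
  have lin: "linear ?L"
    by (intro linearI) (simp_all add: matrix_vector_right_distrib matrix_vector_mult_scaleR)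
  have "?L ` ?B \<subseteq> span ?B"
  proof safe
    fix v e assume v: "H *v v = e *\<^sub>R (g *v v)"
    then have "?L v = e *\<^sub>R v"
      by (simp add: matrix_vector_mult_scaleR posdef_mult_inverse[OF g])
    moreover have "v \<in> span ?B" using v by (intro span_base) blast
    ultimately show "?L v \<in> span ?B" by (simp add: span_scale)
  qed
  then have "span (?L ` ?B) \<subseteq> span ?B" by (rule span_minimal) (rule subspace_span)
  then have L_span: "?L w \<in> span ?B" if "w \<in> span ?B" for w
    using that unfolding linear_span_image[OF lin] by blast
  have sW: "subspace W"
    unfolding W_def by (auto simp: subspace_def bil_linear)
  \<comment> \<open>The inverse of \<open>g\<close> turns the Euclidean normal \<open>z\<close> of
    the span into a \<open>g\<close>-orthogonal vector.\<close>
  have "matrix_inv g *v z \<in> W"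
    unfolding W_def using z(2) by (auto simp: bil_inner posdef_mult_inverse[OF g] inner_commute)
  moreover have "matrix_inv g *v z \<noteq> 0"
    using z(1) posdef_mult_inverse(1)[OF g, of z] by auto
  ultimately have "W \<noteq> {0}" by blast
  have "?L u \<in> W" if u: "u \<in> W" for u
    unfolding W_def
  proof safe
    fix w assume "w \<in> span ?B"
    then have "bil g (?L w) u = 0" using u L_span unfolding W_def by blast
    then show "bil g w (?L u) = 0"
      using posdef_sym[OF g, of w "?L u"] bil_sym[OF H, of u w] by (simp add: bil_shape[OF g H])
  qed
  from relative_eigenvector_exists[OF g H sW \<open>W \<noteq> {0}\<close> this]
  obtain v where v: "v \<in> W" "v \<noteq> 0" "v \<in> ?B" by blast
  from span_base[OF v(3)] have "bil g v v = 0" using v(1) unfolding W_def by blast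
  then show False using posdef_pos[OF g v(2)] by simp
qed

text \<open>With the eigenbasis as its columns, \<open>T\<close> conjugates \<open>L\<close> to the
  diagonal \<open>D\<close>, and conjugation preserves the trace.\<close>

lemma trace_eq_sum_eigenvalues:
  fixes L :: "real ^ 'n ^ 'n"
  assumes B: "independent B" "span B = UNIV" and ev: "\<And>b. b \<in> B \<Longrightarrow> L *v b = ev b *\<^sub>R b"
  shows "trace L = (\<Sum>b\<in>B. ev b)"
proof -
  have fin: "finite B" using B(1) by (rule independent_imp_finite)
  have "card B = CARD('n)"
    using dim_eq_card_independent[OF B(1)] dim_span[of B] by (simp add: B(2))
  then obtain p where p: "bij_betw p (UNIV :: 'n set) B"
    using finite_same_card_bij[of "UNIV :: 'n set" B] fin by auto
  define T :: "real ^ 'n ^ 'n" where "T = (\<chi> i j. p j $ i)"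
  define D :: "real ^ 'n ^ 'n" where "D = (\<chi> i j. if i = j then ev (p j) else 0)"
  have col: "column j T = p j" for j by (simp add: column_def T_def vec_eq_iff)
  have "columns T = B" using p by (auto simp: columns_def col bij_betw_def)
  then have "span (columns T) = UNIV" using B(2) by simp
  then obtain T' where T': "T ** T' = mat 1"
    using matrix_right_invertible_span_columns[of T] unfolding span_vec_eq by blast
  then have T'T: "T' ** T = mat 1" using matrix_left_right_inverse by blast
  have "(L ** T) $ i $ j = (T ** D) $ i $ j" for i j
  proof -
    have "p j \<in> B" using p by (auto simp: bij_betw_def)
    have "(L ** T) $ i $ j = (L *v p j) $ i"
      by (simp add: matrix_matrix_mult_def matrix_vector_mult_def T_def)
    also have "\<dots> = p j $ i * ev (p j)" by (simp add: ev[OF \<open>p j \<in> B\<close>])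
    also have "\<dots> = (\<Sum>k\<in>UNIV. if k = j then p k $ i * ev (p k) else 0)" by simp
    also have "\<dots> = (\<Sum>k\<in>UNIV. T $ i $ k * D $ k $ j)"
      by (intro sum.cong refl) (simp add: T_def D_def)
    also have "\<dots> = (T ** D) $ i $ j" by (simp add: matrix_matrix_mult_def)
    finally show ?thesis .
  qed
  then have LT: "L ** T = T ** D" by (simp add: vec_eq_iff)
  have "trace L = trace ((L ** T) ** T')" by (simp add: matrix_mul_assoc[symmetric] T')
  also have "\<dots> = trace (T' ** (T ** D))" unfolding LT by (rule trace_mul_sym)
  also have "\<dots> = trace D" by (simp add: matrix_mul_assoc T'T)
  also have "\<dots> = (\<Sum>j\<in>UNIV. ev (p j))" by (simp add: trace_def D_def)
  also have "\<dots> = (\<Sum>b\<in>B. ev b)" by (rule sum.reindex_bij_betw[OF p])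
  finally show ?thesis .
qed

lemma transpose_eq_nth: "transpose E = E \<Longrightarrow> E $ i $ j = E $ j $ i"
  by (auto simp: transpose_def vec_eq_iff)

lemma matrix_inv_sym:
  assumes "posdef g"
  shows "matrix_inv g $ i $ j = matrix_inv g $ j $ i"
proof -
  have g: "transpose g = g" using assms unfolding posdef_def by blast
  note i = invertible_inverse[OF posdef_invertible[OF assms]]
  have "transpose (matrix_inv g) ** g = mat 1"
    using arg_cong[OF i(1), of transpose] by (simp add: matrix_transpose_mul g)
  then have "transpose (matrix_inv g) ** (g ** matrix_inv g) = matrix_inv g"
    unfolding matrix_mul_assoc by simp
  then have "transpose (matrix_inv g) = matrix_inv g" by (simp add: i(1))
  then show ?thesis by (rule transpose_eq_nth)
qed

lemma tr_tensor_eq_trace: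
  assumes "posdef g" "transpose E = E"
  shows "tr_tensor g E = trace (matrix_inv g ** E)"
  unfolding tr_tensor_def trace_def matrix_matrix_mult_def
  by (simp, intro sum.cong refl) (simp add: transpose_eq_nth[OF assms(2)])

lemma sq_tensor_eigenvector:
  assumes "posdef g" "E *v u = e *\<^sub>R (g *v u)"
  shows "sq_tensor g E *v u = e\<^sup>2 *\<^sub>R (g *v u)"
proof -
  have "sq_tensor g E = E ** (matrix_inv g ** E)"
    by (simp add: sq_tensor_def matrix_matrix_mult_def vec_eq_iff sum_distrib_left mult_ac)
  then have "sq_tensor g E *v u = E *v (matrix_inv g *v (E *v u))"
    by (simp only: matrix_vector_mul_assoc)
  then show ?thesis
    by (simp add: assms(2) matrix_vector_mult_scaleR posdef_mult_inverse[OF assms(1)] power2_eq_square)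
qed

section \<open>Three principal curvatures\<close>

locale three_curvatures =
  fixes g H :: "real ^ 'n::finite ^ 'n" and l0 l1 l2 :: real and n1 n2 :: nat
  assumes g: "posdef g" and H: "transpose H = H"
    and distinct: "l0 \<noteq> l1" "l0 \<noteq> l2" "l1 \<noteq> l2"
    and eigenvalues: "eigenvalues (shape_operator g H) = {l0, l1, l2}"
    and multiplicities: "dim (eigenspace (shape_operator g H) l0) = 1"
      "dim (eigenspace (shape_operator g H) l1) = n1" "dim (eigenspace (shape_operator g H) l2) = n2"
begin

definition E :: "real \<Rightarrow> (real ^ 'n) set" where
  "E e = {u. H *v u = e *\<^sub>R (g *v u)}"

lemma eigenspace_eq: "eigenspace (shape_operator g H) = E"
  by (simp add: eigenspace_shape_operator[OF g H] E_def fun_eq_iff)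

lemma subspace_E: "subspace (E e)"
  by (simp add: subspace_def E_def matrix_vector_right_distrib matrix_vector_mult_scaleR algebra_simps)

lemma eigenvalue_iff: "(\<exists>v\<in>E e. v \<noteq> 0) \<longleftrightarrow> e \<in> {l0, l1, l2}"
  unfolding eigenvalues[symmetric] eigenspace_eq[symmetric] by (auto simp: eigenvalues_def eigenspace_def)

lemma eigenvector:
  assumes "e \<in> {l0, l1, l2}"
  obtains v where "v \<noteq> 0" "H *v v = e *\<^sub>R (g *v v)" "g *v v \<noteq> 0"
proof -
  obtain v where v: "v \<in> E e" "v \<noteq> 0" using assms eigenvalue_iff by blast
  have "g *v v \<noteq> 0" using posdef_mult_eq_iff[OF g, of v 0] v(2) by simp
  then show ?thesis using v that unfolding E_def by blast
qed

lemma span_E: "span (E l0 \<union> E l1 \<union> E l2) = UNIV"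
proof -
  have "{v. \<exists>e. H *v v = e *\<^sub>R (g *v v)} \<subseteq> E l0 \<union> E l1 \<union> E l2"
  proof safe
    fix v e assume v: "H *v v = e *\<^sub>R (g *v v)" "v \<notin> E l2" "v \<notin> E l1"
    have "v \<noteq> 0" using v(2) by (auto simp: E_def)
    then have "e \<in> {l0, l1, l2}" using v(1) eigenvalue_iff unfolding E_def by blast
    then show "v \<in> E l0" using v unfolding E_def by auto
  qed
  from span_mono[OF this] show ?thesis unfolding span_relative_eigenvectors[OF g H] by blast
qed

text \<open>The three eigenspaces span, so an identity of matrices becomes a scalar identity at each
  principal curvature.\<close>

lemma matrix_eqI:
  assumes "\<And>e u. e \<in> {l0, l1, l2} \<Longrightarrow> H *v u = e *\<^sub>R (g *v u) \<Longrightarrow> M *v u = M' *v u"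
  shows "M = (M' :: real ^ 'n ^ 'm)"
proof -
  have "M *v u = M' *v u" for u
  proof (rule linear_eq_on_span[of _ _ "E l0 \<union> E l1 \<union> E l2"])
    show "u \<in> span (E l0 \<union> E l1 \<union> E l2)" by (simp add: span_E)
  qed (use assms in \<open>auto simp: E_def\<close>)
  then show ?thesis by (simp add: matrix_eq)
qed

lemma orthogonal_E:
  assumes "u \<in> E e" "v \<in> E e'" "e \<noteq> e'"
  shows "bil g u v = 0"
proof -
  have "e' * bil g u v = bil H u v" using assms(2) by (simp add: E_def bil_inner)
  also have "\<dots> = bil H v u" by (rule bil_sym[OF H])
  also have "\<dots> = e * bil g v u" using assms(1) by (simp add: E_def bil_inner)
  finally show ?thesis using assms(3) posdef_sym[OF g, of u v] by simp
qed

lemma sum_E_eq_zero: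
  assumes "u0 \<in> E l0" "u1 \<in> E l1" "u2 \<in> E l2" "u0 + u1 + u2 = 0"
  shows "u0 = 0" "u1 = 0" "u2 = 0"
proof -
  have zero: "u = 0" if "bil g u (u0 + u1 + u2) = bil g u u" for u
    using that assms(4) posdef_pos[OF g, of u] by fastforce
  show "u0 = 0" using distinct assms(1-3) orthogonal_E by (intro zero) (simp add: bil_linear)
  show "u1 = 0" using distinct assms(1-3) orthogonal_E by (intro zero) (simp add: bil_linear)
  show "u2 = 0" using distinct assms(1-3) orthogonal_E by (intro zero) (simp add: bil_linear)
qed

text \<open>Bases of the three eigenspaces together form an eigenbasis whose blocks have the
  multiplicities as sizes. Besides expressing \<open>\<mu>\<close> by \<open>n1\<close> and
  \<open>n2\<close>, this shows that the trace is the same in every chart.\<close>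

lemma trace_H: "tr_tensor g H = l0 + real n1 * l1 + real n2 * l2"
proof -
  obtain B0 where B0: "B0 \<subseteq> E l0" "independent B0" "E l0 \<subseteq> span B0" "card B0 = dim (E l0)"
    using basis_exists by blast
  obtain B1 where B1: "B1 \<subseteq> E l1" "independent B1" "E l1 \<subseteq> span B1" "card B1 = dim (E l1)"
    using basis_exists by blast
  obtain B2 where B2: "B2 \<subseteq> E l2" "independent B2" "E l2 \<subseteq> span B2" "card B2 = dim (E l2)"
    using basis_exists by blast
  have fin: "finite B0" "finite B1" "finite B2" using B0(2) B1(2) B2(2) independent_imp_finite by blast+
  have E_inter: "u = 0" if "u \<in> E e" "u \<in> E e'" "e \<noteq> e'" for u e e'
    using orthogonal_E[OF that] posdef_pos[OF g, of u] by fastforce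
  have z: "0 \<notin> B0" "0 \<notin> B1" "0 \<notin> B2" using B0(2) B1(2) B2(2) dependent_zero by auto
  have "B0 \<inter> B1 = {}" "B0 \<inter> B2 = {}" "B1 \<inter> B2 = {}"
    using B0(1) B1(1) B2(1) z E_inter[OF _ _ distinct(1)] E_inter[OF _ _ distinct(2)]
      E_inter[OF _ _ distinct(3)] by blast+
  then have disj: "B0 \<inter> B1 = {}" "(B0 \<union> B1) \<inter> B2 = {}" by auto
  let ?B = "B0 \<union> B1 \<union> B2"
  have "span ?B = UNIV"
  proof -
    have "E l0 \<union> E l1 \<union> E l2 \<subseteq> span ?B"
      using B0(3) B1(3) B2(3) span_mono[of B0 ?B] span_mono[of B1 ?B] span_mono[of B2 ?B] by blast
    then show ?thesis using span_E span_minimal[of "E l0 \<union> E l1 \<union> E l2" "span ?B"] by auto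
  qed
  moreover have "independent ?B"
  proof
    assume "dependent ?B"
    then obtain r where r: "\<exists>v\<in>?B. r v \<noteq> 0" "(\<Sum>v\<in>?B. r v *\<^sub>R v) = 0"
      using dependent_finite[of ?B] fin by auto
    let ?s = "\<lambda>B. \<Sum>v\<in>B. r v *\<^sub>R v"
    have "?s B0 + ?s B1 + ?s B2 = 0"
      using r(2) fin disj by (simp add: sum.union_disjoint)
    moreover have "?s B0 \<in> E l0" "?s B1 \<in> E l1" "?s B2 \<in> E l2"
      using B0(1) B1(1) B2(1) by (auto intro!: subspace_sum subspace_scale subspace_E)
    ultimately have "?s B0 = 0" "?s B1 = 0" "?s B2 = 0" using sum_E_eq_zero by blast+
    then show False
      using r(1) fin B0(2) B1(2) B2(2) dependent_finite[of B0] dependent_finite[of B1] dependent_finite[of B2]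
      by blast
  qed
  moreover define ev where "ev b = (if b \<in> B0 then l0 else if b \<in> B1 then l1 else l2)" for b
  have "(matrix_inv g ** H) *v b = ev b *\<^sub>R b" if "b \<in> ?B" for b
  proof -
    have "b \<in> E (ev b)" using that B0(1) B1(1) B2(1) unfolding ev_def by auto
    then show ?thesis
      by (simp add: E_def matrix_vector_mul_assoc[symmetric] matrix_vector_mult_scaleR posdef_mult_inverse[OF g])
  qed
  ultimately have "tr_tensor g H = (\<Sum>b\<in>?B. ev b)"
    unfolding tr_tensor_eq_trace[OF g H] by (intro trace_eq_sum_eigenvalues) auto
  also have "\<dots> = (\<Sum>b\<in>B0. ev b) + (\<Sum>b\<in>B1. ev b) + (\<Sum>b\<in>B2. ev b)"
    using fin disj by (simp add: sum.union_disjoint)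
  also have "(\<Sum>b\<in>B0. ev b) = (\<Sum>b\<in>B0. l0)" by (rule sum.cong) (auto simp: ev_def)
  also have "(\<Sum>b\<in>B1. ev b) = (\<Sum>b\<in>B1. l1)" using disj by (intro sum.cong) (auto simp: ev_def)
  also have "(\<Sum>b\<in>B2. ev b) = (\<Sum>b\<in>B2. l2)" using disj by (intro sum.cong) (auto simp: ev_def)
  finally show ?thesis
    using B0(4) B1(4) B2(4) multiplicities unfolding eigenspace_eq by simp
qed

end

section \<open>Eigenvalues of the Ricci tensor and the factors of \<open>\<mu>\<close>\<close>

context three_curvatures
begin

abbreviation t :: real where "t \<equiv> tr_tensor g H"

text \<open>The left side is minus the cubic \<open>(x - l0) (x - l1) (x - l2)\<close> at
  \<open>x = l0 + l1 + l2 - t\<close>, where for instance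
  \<open>x - l0 = - (t - l1 - l2)\<close>.\<close>

lemma mu_factors:
  "l0 * l1 * l2 + (l0 + l1 + l2 - t) * ((- l0 * (l1 + l2) - l1 * l2) + t * (l0 + l1 + l2 - t))
    = (t - l1 - l2) * (t - l0 - l1) * (t - l0 - l2)"
  by (simp add: algebra_simps)

text \<open>By \<open>trace_H\<close> the factor \<open>t - l1 - l2\<close> is the first one on the
  right; with \<open>q = t - l0\<close> the other two multiply to
  \<open>(q - l1) (q - l2) = l1 l2 + q (q - l1 - l2)\<close>.\<close>

lemma mu_multiplicities:
  "(t - l1 - l2) * (t - l0 - l1) * (t - l0 - l2)
    = (l0 + (real n1 - 1) * l1 + (real n2 - 1) * l2) *
      (l1 * l2 + (real n1 * l1 + real n2 * l2) * ((real n1 - 1) * l1 + (real n2 - 1) * l2))"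
  unfolding trace_H by (simp add: algebra_simps)

text \<open>\<open>S\<close> is to be the Ricci tensor, with \<open>k = (n - 1) c\<close>.\<close>

context
  fixes S :: "real ^ 'n ^ 'n" and k :: real
  assumes S: "S = t *\<^sub>R H - sq_tensor g H + k *\<^sub>R g"
begin

lemma S_eigenvector:
  assumes "H *v u = e *\<^sub>R (g *v u)"
  shows "S *v u = (t * e - e\<^sup>2 + k) *\<^sub>R (g *v u)"
  unfolding S
  by (simp add: matrix_vector_mult_add_rdistrib matrix_vector_mult_diff_rdistrib
      scaleR_matrix_vector_assoc[symmetric] assms sq_tensor_eigenvector[OF g assms] algebra_simps)

lemma S_combination_eigenvector:
  assumes "H *v u = e *\<^sub>R (g *v u)"
  shows "(r *\<^sub>R sq_tensor g S + b *\<^sub>R S + a *\<^sub>R g) *v u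
    = (r * (t * e - e\<^sup>2 + k)\<^sup>2 + b * (t * e - e\<^sup>2 + k) + a) *\<^sub>R (g *v u)"
  by (simp add: matrix_vector_mult_add_rdistrib scaleR_matrix_vector_assoc[symmetric]
      S_eigenvector[OF assms] sq_tensor_eigenvector[OF g S_eigenvector[OF assms]] algebra_simps)

text \<open>Put \<open>s = t e - e^2\<close>, the eigenvalue of \<open>S\<close> less
  \<open>k\<close>. The cubic \<open>e^3 = \<alpha> e^2 + \<beta> e + \<gamma>\<close> gives
  \<open>s^2 = ((\<alpha> - t)^2 + \<beta>) e^2 + ((\<alpha> - 2 t) \<beta> + \<gamma>) e + \<gamma>
  (\<alpha> - 2 t)\<close>. Adding \<open>((\<alpha> - t)^2 + \<beta>) s\<close> removes
  \<open>e^2\<close> and leaves the factor of \<open>H\<close> as coefficient of \<open>e\<close>;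
  the terms with \<open>k\<close> come from the shift.\<close>

lemma quadratic_in_S:
  fixes \<alpha> \<beta> \<gamma> :: real
  assumes \<alpha>: "\<alpha> = l0 + l1 + l2" and \<beta>: "\<beta> = - l0 * (l1 + l2) - l1 * l2" and \<gamma>: "\<gamma> = l0 * l1 * l2"
  shows "sq_tensor g S + ((\<alpha> - t)\<^sup>2 + \<beta> - 2 * k) *\<^sub>R S
      + (k\<^sup>2 - (\<beta> + (\<alpha> - t)\<^sup>2) * k - \<gamma> * (\<alpha> - 2 * t)) *\<^sub>R g
    = (\<gamma> + (\<alpha> - t) * (\<beta> + t * (\<alpha> - t))) *\<^sub>R H"
proof (rule matrix_eqI)
  fix e u assume e: "e \<in> {l0, l1, l2}" and u: "H *v u = e *\<^sub>R (g *v u)"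
  have "(t * e - e\<^sup>2 + k)\<^sup>2 + ((\<alpha> - t)\<^sup>2 + \<beta> - 2 * k) * (t * e - e\<^sup>2 + k)
      + (k\<^sup>2 - (\<beta> + (\<alpha> - t)\<^sup>2) * k - \<gamma> * (\<alpha> - 2 * t))
    = (\<gamma> + (\<alpha> - t) * (\<beta> + t * (\<alpha> - t))) * e"
    using e unfolding \<alpha> \<beta> \<gamma> by (elim insertE emptyE; hypsubst) (simp_all add: power2_eq_square algebra_simps)
  with S_combination_eigenvector[OF u, of 1 "(\<alpha> - t)\<^sup>2 + \<beta> - 2 * k" "k\<^sup>2 - (\<beta> + (\<alpha> - t)\<^sup>2) * k - \<gamma> * (\<alpha> - 2 * t)"]
  show "(sq_tensor g S + ((\<alpha> - t)\<^sup>2 + \<beta> - 2 * k) *\<^sub>R S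
      + (k\<^sup>2 - (\<beta> + (\<alpha> - t)\<^sup>2) * k - \<gamma> * (\<alpha> - 2 * t)) *\<^sub>R g) *v u
    = ((\<gamma> + (\<alpha> - t) * (\<beta> + t * (\<alpha> - t))) *\<^sub>R H) *v u"
    by (simp add: scaleR_matrix_vector_assoc[symmetric] u)
qed

text \<open>Each principal curvature has a nonzero eigenvector, on which a matrix relation becomes a
  polynomial equation for the eigenvalue of \<open>S\<close>.\<close>

lemma S_relation:
  assumes "r *\<^sub>R sq_tensor g S + b *\<^sub>R S + a *\<^sub>R g = 0" "e \<in> {l0, l1, l2}"
  shows "r * (t * e - e\<^sup>2 + k)\<^sup>2 + b * (t * e - e\<^sup>2 + k) + a = 0"
proof -
  obtain v where v: "v \<noteq> 0" "H *v v = e *\<^sub>R (g *v v)" "g *v v \<noteq> 0"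
    using eigenvector[OF assms(2)] .
  show ?thesis using S_combination_eigenvector[OF v(2), of r b a] v(3) unfolding assms(1) by simp
qed

text \<open>A common eigenvalue of \<open>S\<close> at \<open>l0\<close>, \<open>l1\<close>,
  \<open>l2\<close> would force both \<open>t - l0 = l1\<close> and \<open>t - l0 = l2\<close>,
  against distinctness. The factors of \<open>\<mu>\<close> may vanish here.\<close>

lemma S_not_proportional: "S \<noteq> \<kappa> *\<^sub>R g"
proof
  assume "S = \<kappa> *\<^sub>R g"
  then have "t * e - e\<^sup>2 + k = \<kappa>" if "e \<in> {l0, l1, l2}" for e
    using S_relation[of 0 1 "- \<kappa>" e] that by simp
  from this[of l0] this[of l1] this[of l2]
  have "(l0 - l1) * (t - l0 - l1) = 0" "(l0 - l2) * (t - l0 - l2) = 0"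
    by (simp_all add: algebra_simps power2_eq_square)
  then show False using distinct by simp
qed

text \<open>Nonzero factors make the three eigenvalues of \<open>S\<close> distinct, and a
  polynomial of degree at most two with three roots is zero.\<close>

lemma S_independent:
  assumes mu: "(t - l1 - l2) * (t - l0 - l1) * (t - l0 - l2) \<noteq> 0"
    and rel: "r *\<^sub>R sq_tensor g S + b *\<^sub>R S + a *\<^sub>R g = 0"
  shows "r = 0 \<and> b = 0 \<and> a = 0"
proof -
  define s where "s e = t * e - e\<^sup>2 + k" for e
  have diff: "s x - s y = (x - y) * (t - x - y)" for x y
    by (simp add: s_def algebra_simps power2_eq_square)
  have ne: "s l0 \<noteq> s l1" "s l0 \<noteq> s l2" "s l1 \<noteq> s l2"
    using diff[of l0 l1] diff[of l0 l2] diff[of l1 l2] distinct mu by auto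
  have eq: "r * (s e)\<^sup>2 + b * s e + a = 0" if "e \<in> {l0, l1, l2}" for e
    using S_relation[OF rel that] by (simp add: s_def)
  have "(s l0 - s l1) * (r * (s l0 + s l1) + b) = 0" "(s l0 - s l2) * (r * (s l0 + s l2) + b) = 0"
    using eq[of l0] eq[of l1] eq[of l2] by (simp_all add: algebra_simps power2_eq_square)
  then have e1: "r * (s l0 + s l1) + b = 0" "r * (s l0 + s l2) + b = 0" using ne by auto
  then have "r * (s l1 - s l2) = 0" unfolding ring_distribs by linarith
  then have "r = 0" using ne by simp
  then show ?thesis using e1 eq[of l0] by simp
qed

end

end

section \<open>The Ricci tensor of a hypersurface\<close>

text \<open>The trace of the Gauss equation; \<open>G_tensor\<close> contributes
  \<open>(n - 1) g\<close> because the trace of \<open>g\<close> is the dimension and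
  \<open>sq_tensor g g = g\<close>.\<close>

lemma ricci_contraction:
  fixes g H :: "real ^ 'n::finite ^ 'n"
  assumes g: "posdef g"
    and R: "\<And>h i j k. R h i j k = H $ i $ j * H $ h $ k - H $ h $ j * H $ i $ k + c * G_tensor g h i j k"
  shows "(\<chi> h k. \<Sum>i\<in>UNIV. \<Sum>j\<in>UNIV. matrix_inv g $ i $ j * R h i j k)
    = tr_tensor g H *\<^sub>R H - sq_tensor g H + ((real CARD('n) - 1) * c) *\<^sub>R g"
proof -
  note i = invertible_inverse[OF posdef_invertible[OF g]]
  \<comment> \<open>The contraction pairs the summation indices crosswise compared with
    \<open>sq_tensor\<close>, which the symmetry of the inverse metric repairs.\<close>
  have sq: "(\<Sum>i\<in>UNIV. \<Sum>j\<in>UNIV. matrix_inv g $ i $ j * (E $ h $ j * E $ i $ k)) = sq_tensor g E $ h $ k" for E h k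
    unfolding sq_tensor_def
    by (subst sum.swap) (simp add: matrix_inv_sym[OF g, of i j for i j] mult.assoc)
  have "sq_tensor g g = g ** (matrix_inv g ** g)"
    by (simp add: sq_tensor_def matrix_matrix_mult_def vec_eq_iff sum_distrib_left mult_ac)
  then have gg: "sq_tensor g g = g" by (simp add: i)
  have tg: "tr_tensor g g = CARD('n)"
    using g by (simp add: tr_tensor_eq_trace[OF g] posdef_def i trace_I)
  have "(\<Sum>i\<in>UNIV. \<Sum>j\<in>UNIV. matrix_inv g $ i $ j * R h i j k)
     = tr_tensor g H * H $ h $ k - sq_tensor g H $ h $ k + c * (tr_tensor g g * g $ h $ k - sq_tensor g g $ h $ k)" for h k
    unfolding sq[symmetric] R G_tensor_def tr_tensor_def
    by (simp add: sum_distrib_left sum_distrib_right sum_subtractf sum.distrib algebra_simps)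
  then show ?thesis
    by (simp add: vec_eq_iff gg tg algebra_simps)
qed

section \<open>Continuity of the Ricci tensor and openness of linear independence\<close>

definition ricci_coord :: "(real ^ 'n::finite \<Rightarrow> real ^ 'n ^ 'n) \<Rightarrow> real ^ 'n \<Rightarrow> real ^ 'n ^ 'n" where
  "ricci_coord h y = (\<chi> a d. \<Sum>i\<in>UNIV. \<Sum>j\<in>UNIV. matrix_inv (h y) $ i $ j * riemann_coord h y a i j d)"

lemma differentiable_continuous_on:
  "(\<And>y. y \<in> V \<Longrightarrow> F differentiable (at y)) \<Longrightarrow> continuous_on V F"
  by (simp add: continuous_at_imp_continuous_on differentiable_imp_continuous_within)

lemma continuous_on_matrix:
  assumes "\<And>i j. continuous_on V (\<lambda>y. M y $ i $ j)"
  shows "continuous_on V (M :: 'a::topological_space \<Rightarrow> real ^ 'n ^ 'm)"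
  using continuous_on_vec_lambda[of V "\<lambda>i y. M y $ i"] continuous_on_vec_lambda[of V "\<lambda>j y. M y $ i $ j" for i] assms
  by simp

context coord_metric
begin

lemma continuous_on_inverse: "continuous_on V (\<lambda>y. matrix_inv (h y) $ i $ j)"
  by (intro differentiable_continuous_on differentiable_nth differentiable_matrix_inv[OF open_V]
      posdef_invertible posdef diff)

text \<open>The definition contains derivatives of Christoffel symbols, which have been shown to
  exist but not to be continuous. \<open>curvature_formula\<close> replaces them by second
  derivatives of the smooth \<open>h\<close>.\<close>

lemma continuous_on_riemann_coord: "continuous_on V (\<lambda>y. riemann_coord h y a b c d)"
proof -
  have D: "continuous_on V (dird u (dird v h))" for u v
    by (intro smooth_on_continuous smooth_on_dird smooth)
  have C: "continuous_on V (\<lambda>y. conn h y u v)" for u v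
    by (intro differentiable_continuous_on conn_along(1)) auto
  have "continuous_on V (\<lambda>y. bil (h y) (curv_op h y u v w) z)" for u v w z
    by (simp only: curvature_formula cong: continuous_on_cong)
       (intro continuous_intros continuous_on_bil D C smooth_on_continuous smooth)
  then show ?thesis by (simp only: riemann_coord_eq cong: continuous_on_cong)
qed

lemma continuous_on_ricci_coord: "continuous_on V (ricci_coord h)"
  by (rule continuous_on_matrix)
     (simp add: ricci_coord_def, intro continuous_intros continuous_on_inverse continuous_on_riemann_coord)

lemma continuous_on_sq_tensor:
  assumes "continuous_on V E"
  shows "continuous_on V (\<lambda>y. sq_tensor (h y) (E y))"
  by (rule continuous_on_matrix)
     (simp add: sq_tensor_def, intro continuous_intros continuous_on_inverse assms)

end

text \<open>Stated for a triple, since a set of vectors would hide coincidences such as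
  \<open>u = v\<close>.\<close>

definition independent3 :: "'a::real_vector \<Rightarrow> 'a \<Rightarrow> 'a \<Rightarrow> bool" where
  "independent3 u v w \<longleftrightarrow> (\<forall>r s t. r *\<^sub>R u + s *\<^sub>R v + t *\<^sub>R w = 0 \<longrightarrow> r = 0 \<and> s = 0 \<and> t = 0)"

definition gram3 :: "'a::real_inner \<Rightarrow> 'a \<Rightarrow> 'a \<Rightarrow> real ^ 3 ^ 3" where
  "gram3 u v w = vector [vector [u \<bullet> u, u \<bullet> v, u \<bullet> w], vector [v \<bullet> u, v \<bullet> v, v \<bullet> w], vector [w \<bullet> u, w \<bullet> v, w \<bullet> w]]"

lemma gram3_mult:
  "gram3 u v w *v x = vector [u \<bullet> (x $ 1 *\<^sub>R u + x $ 2 *\<^sub>R v + x $ 3 *\<^sub>R w),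
     v \<bullet> (x $ 1 *\<^sub>R u + x $ 2 *\<^sub>R v + x $ 3 *\<^sub>R w), w \<bullet> (x $ 1 *\<^sub>R u + x $ 2 *\<^sub>R v + x $ 3 *\<^sub>R w)]"
  by (simp add: vec_eq_iff forall_3 gram3_def matrix_vector_mult_def sum_3 inner_add_right mult.commute)

text \<open>A combination orthogonal to \<open>u\<close>, \<open>v\<close> and \<open>w\<close> is
  orthogonal to itself, so the kernel of the Gram matrix consists of the linear relations.
  Independence thus becomes the nonvanishing of a continuous function.\<close>

lemma independent3_iff_det: "independent3 u v w \<longleftrightarrow> det (gram3 u v w) \<noteq> 0"
proof -
  let ?c = "\<lambda>x :: real ^ 3. x $ 1 *\<^sub>R u + x $ 2 *\<^sub>R v + x $ 3 *\<^sub>R w"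
  have ker: "gram3 u v w *v x = 0 \<longleftrightarrow> ?c x = 0" for x
  proof
    assume "gram3 u v w *v x = 0"
    then have "u \<bullet> ?c x = 0" "v \<bullet> ?c x = 0" "w \<bullet> ?c x = 0"
      unfolding gram3_mult by (simp_all add: vec_eq_iff forall_3)
    then have "?c x \<bullet> ?c x = 0" by (simp only: inner_add_left inner_scaleR_left mult_zero_right add_0_left)
    then show "?c x = 0" by simp
  qed (simp add: gram3_mult vec_eq_iff forall_3)
  have "det (gram3 u v w) \<noteq> 0 \<longleftrightarrow> (\<forall>x. gram3 u v w *v x = 0 \<longrightarrow> x = 0)"
    by (metis invertible_det_nz invertible_left_inverse matrix_left_invertible_ker)
  also have "\<dots> \<longleftrightarrow> (\<forall>x. ?c x = 0 \<longrightarrow> x = 0)" by (simp add: ker)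
  also have "\<dots> \<longleftrightarrow> independent3 u v w"
  proof
    assume *: "\<forall>x. ?c x = 0 \<longrightarrow> x = 0"
    show "independent3 u v w"
      unfolding independent3_def
    proof (intro allI impI)
      fix r s t assume "r *\<^sub>R u + s *\<^sub>R v + t *\<^sub>R w = 0"
      then have "(vector [r, s, t] :: real ^ 3) = 0" using *[rule_format, of "vector [r, s, t]"] by simp
      then show "r = 0 \<and> s = 0 \<and> t = 0" by (simp add: vec_eq_iff forall_3)
    qed
  qed (auto simp: independent3_def vec_eq_iff forall_3)
  finally show ?thesis by simp
qed

lemma open_independent3:
  fixes a b d :: "'a::topological_space \<Rightarrow> 'b::real_inner"
  assumes "open V" "continuous_on V a" "continuous_on V b" "continuous_on V d"
  shows "open {y \<in> V. independent3 (a y) (b y) (d y)}"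
proof -
  have "continuous_on V (\<lambda>y. det (gram3 (a y) (b y) (d y)))"
    unfolding det_3 gram3_def by (simp, intro continuous_intros assms)
  then have "open (V \<inter> (\<lambda>y. det (gram3 (a y) (b y) (d y))) -` (- {0}))"
    using assms(1) by (intro continuous_open_preimage) auto
  moreover have "V \<inter> (\<lambda>y. det (gram3 (a y) (b y) (d y))) -` (- {0}) = {y \<in> V. independent3 (a y) (b y) (d y)}"
    by (auto simp: independent3_iff_det)
  ultimately show ?thesis by simp
qed

section \<open>Charts\<close>

lemma is_chart_inj:
  assumes "is_chart X \<phi>"
  shows "inj_on (coords \<phi>) (dom_ch \<phi>)" "dom_ch \<phi> \<subseteq> topspace X"
proof -
  show 1: "dom_ch \<phi> \<subseteq> topspace X" using assms openin_subset unfolding is_chart_def by blast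
  show "inj_on (coords \<phi>) (dom_ch \<phi>)"
    using assms 1 unfolding is_chart_def homeomorphic_map_def quotient_map_def
    by (simp add: homeomorphic_eq_everything_map inf.absorb2)
qed

lemma uncoords_coords [simp]:
  "is_chart X \<phi> \<Longrightarrow> p \<in> dom_ch \<phi> \<Longrightarrow> uncoords \<phi> (coords \<phi> p) = p"
  by (simp add: is_chart_inj inv_into_f_f)

lemma open_chart_image:
  assumes "is_chart X \<phi>" "openin X T" "T \<subseteq> dom_ch \<phi>"
  shows "open (coords \<phi> ` T)"
proof -
  have "open_map (subtopology X (dom_ch \<phi>)) (top_of_set (coords \<phi> ` dom_ch \<phi>)) (coords \<phi>)"
    using assms(1) unfolding is_chart_def by (blast intro: homeomorphic_imp_open_map)
  moreover have "openin (subtopology X (dom_ch \<phi>)) T"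
    using assms(2,3) by (auto simp: openin_subtopology)
  ultimately have "openin (top_of_set (coords \<phi> ` dom_ch \<phi>)) (coords \<phi> ` T)"
    unfolding open_map_def by blast
  then show ?thesis
    using assms(1) unfolding is_chart_def by (blast intro: openin_open_trans)
qed

lemma openin_chart_preimage:
  assumes "is_chart X \<phi>" "open W"
  shows "openin X {p \<in> dom_ch \<phi>. coords \<phi> p \<in> W}"
proof -
  have "continuous_map (subtopology X (dom_ch \<phi>)) (top_of_set (coords \<phi> ` dom_ch \<phi>)) (coords \<phi>)"
    using assms(1) unfolding is_chart_def by (blast intro: homeomorphic_imp_continuous_map)
  then have "continuous_map (subtopology X (dom_ch \<phi>)) euclidean (coords \<phi>)"
    by (rule continuous_map_into_fulltopology)
  then have "openin (subtopology X (dom_ch \<phi>)) {p \<in> topspace (subtopology X (dom_ch \<phi>)). coords \<phi> p \<in> W}"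
    by (rule openin_continuous_map_preimage) (simp add: assms(2))
  moreover have "topspace (subtopology X (dom_ch \<phi>)) = dom_ch \<phi>"
    using is_chart_inj(2)[OF assms(1)] by auto
  ultimately have "openin (subtopology X (dom_ch \<phi>)) {p \<in> dom_ch \<phi>. coords \<phi> p \<in> W}"
    by (simp only:)
  then show ?thesis
    by (rule openin_trans_full) (use assms(1) in \<open>simp add: is_chart_def\<close>)
qed

lemma riemannian_manifold_chart:
  assumes "riemannian_manifold X \<A> g" "\<phi> \<in> \<A>"
  shows "is_chart X \<phi>"
  using assms unfolding riemannian_manifold_def smooth_manifold_def by blast

lemma riemannian_manifold_posdef:
  assumes "riemannian_manifold X \<A> g" "\<phi> \<in> \<A>" "p \<in> dom_ch \<phi>"
  shows "posdef (g \<phi> p)"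
  using assms unfolding riemannian_manifold_def riemannian_metric_def posdef_def by blast

lemma riemannian_manifold_coord_metric:
  assumes "riemannian_manifold X \<A> g" "\<phi> \<in> \<A>"
  shows "coord_metric (coords \<phi> ` dom_ch \<phi>) (g \<phi> \<circ> uncoords \<phi>)"
proof
  note chart = riemannian_manifold_chart[OF assms]
  show "open (coords \<phi> ` dom_ch \<phi>)" using chart unfolding is_chart_def by blast
  show "smooth_on (coords \<phi> ` dom_ch \<phi>) (g \<phi> \<circ> uncoords \<phi>)"
    using assms unfolding riemannian_manifold_def riemannian_metric_def by blast
  show "posdef ((g \<phi> \<circ> uncoords \<phi>) y)" if "y \<in> coords \<phi> ` dom_ch \<phi>" for y
    using that chart by (auto intro!: riemannian_manifold_posdef[OF assms])
qed

lemma coord_metric_subset: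
  assumes "coord_metric V h" "open U" "U \<subseteq> V"
  shows "coord_metric U h"
  using assms smooth_on_subset unfolding coord_metric_def by blast

lemma ricci_eq_ricci_coord:
  assumes "is_chart X \<phi>" "p \<in> dom_ch \<phi>"
  shows "ricci g \<phi> p = ricci_coord (g \<phi> \<circ> uncoords \<phi>) (coords \<phi> p)"
  using assms by (simp add: ricci_def ricci_coord_def curv_def)

lemma constant_curvature_coord:
  assumes M: "riemannian_manifold Y \<B> h" and c: "constant_curvature \<B> h c"
    and \<psi>: "\<psi> \<in> \<B>" "q \<in> dom_ch \<psi>"
  shows "bil (h \<psi> q) (curv_op (h \<psi> \<circ> uncoords \<psi>) (coords \<psi> q) a b v) w
    = c * (bil (h \<psi> q) a w * bil (h \<psi> q) b v - bil (h \<psi> q) a v * bil (h \<psi> q) b w)"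
proof -
  interpret coord_metric "coords \<psi> ` dom_ch \<psi>" "h \<psi> \<circ> uncoords \<psi>"
    by (rule riemannian_manifold_coord_metric[OF M \<psi>(1)])
  have eq: "(h \<psi> \<circ> uncoords \<psi>) (coords \<psi> q) = h \<psi> q"
    using riemannian_manifold_chart[OF M \<psi>(1)] \<psi>(2) by simp
  have "sectional_curvature h \<psi> q u v = c" if "u \<noteq> v" "independent {u, v}" for u v
    using c \<psi> that unfolding constant_curvature_def by blast
  then show ?thesis
    using constant_curvature_tensor[of "coords \<psi> q" c a b v w] \<psi>(2)
    unfolding eq sectional_curvature_def curv_def by blast
qed

lemma bil_pullback: "bil (pullback J E) u v = bil E (J *v u) (J *v v)"
proof -
  have "bil (pullback J E) u v = u \<bullet> (transpose J *v (E *v (J *v v)))"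
    unfolding pullback_def bil_inner by (simp only: matrix_vector_mul_assoc matrix_mul_assoc)
  also have "\<dots> = (E *v (J *v v)) \<bullet> (J *v u)"
    by (simp only: transpose_matrix_vector dot_lmul_matrix inner_commute[of u])
  finally show ?thesis by (simp only: bil_inner inner_commute)
qed

lemma jacobian_mult:
  assumes "(F :: real ^ 'n \<Rightarrow> real ^ 'm) differentiable (at x)"
  shows "jacobian F (at x) *v u = dird u F x"
  using jacobian_works[of F "at x"] assms by (simp add: dird_eqI)

locale space_form_hypersurface =
  fixes X :: "'m topology" and \<A> :: "('m, 'n::finite) chart set" and g H :: "('m, 'n) tensor2"
    and Y :: "'q topology" and \<B> :: "('q, 'k::finite) chart set" and h :: "('q, 'k) tensor2"
    and f :: "'m \<Rightarrow> 'q" and \<nu> :: "('q, 'k) chart \<Rightarrow> 'm \<Rightarrow> real ^ 'k" and c :: real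
  assumes codim: "CARD('k) = CARD('n) + 1"
    and ambient: "riemannian_manifold Y \<B> h" "constant_curvature \<B> h c"
    and hypersurface: "riemannian_manifold X \<A> g" "isometric_immersion X \<A> g Y \<B> h f"
    and normal: "unit_normal \<A> \<B> h f \<nu>"
    and H: "second_fundamental_tensor \<A> \<B> h f \<nu> H"
begin

lemma ambient_chart:
  assumes "\<phi> \<in> \<A>" "p \<in> dom_ch \<phi>"
  obtains \<psi> where "\<psi> \<in> \<B>" "f p \<in> dom_ch \<psi>"
proof -
  have "p \<in> topspace X"
    using is_chart_inj(2)[OF riemannian_manifold_chart[OF hypersurface(1) assms(1)]] assms(2) by blast
  then have "f p \<in> topspace Y"
    using hypersurface(2) unfolding isometric_immersion_def smooth_map_def continuous_map_def by blast
  then show ?thesis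
    using that ambient(1) unfolding riemannian_manifold_def smooth_manifold_def by blast
qed

context
  fixes \<phi> \<psi> assumes charts: "\<phi> \<in> \<A>" "\<psi> \<in> \<B>"
begin

abbreviation F where "F \<equiv> loc_rep \<phi> \<psi> f"
abbreviation U where "U \<equiv> coords \<phi> ` (dom_ch \<phi> \<inter> f -` dom_ch \<psi>)"
abbreviation gc where "gc \<equiv> g \<phi> \<circ> uncoords \<phi>"
abbreviation hc where "hc \<equiv> h \<psi> \<circ> uncoords \<psi>"

lemma chart: "is_chart X \<phi>" "is_chart Y \<psi>"
  using riemannian_manifold_chart hypersurface(1) ambient(1) charts by blast+

lemma F_coords: "p \<in> dom_ch \<phi> \<Longrightarrow> F (coords \<phi> p) = coords \<psi> (f p)"
  using chart by (simp add: loc_rep_def)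

lemma open_dom: "open U"
proof (rule open_chart_image[OF chart(1)])
  have cont: "continuous_map X Y f"
    using hypersurface(2) unfolding isometric_immersion_def smooth_map_def by blast
  have "openin X {p \<in> topspace X. f p \<in> dom_ch \<psi>}"
    using chart(2) unfolding is_chart_def by (blast intro: openin_continuous_map_preimage[OF cont])
  then have "openin X (dom_ch \<phi> \<inter> {p \<in> topspace X. f p \<in> dom_ch \<psi>})"
    using chart(1) unfolding is_chart_def by blast
  also have "dom_ch \<phi> \<inter> {p \<in> topspace X. f p \<in> dom_ch \<psi>} = dom_ch \<phi> \<inter> f -` dom_ch \<psi>"
    using is_chart_inj(2)[OF chart(1)] by blast
  finally show "openin X (dom_ch \<phi> \<inter> f -` dom_ch \<psi>)" .
qed simp

lemma smooth_loc_rep: "smooth_on U F"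
  using hypersurface(2) charts unfolding isometric_immersion_def smooth_map_def by blast

lemma immersion:
  assumes "p \<in> dom_ch \<phi>" "f p \<in> dom_ch \<psi>"
  shows "inj (\<lambda>u. dird u F (coords \<phi> p))"
    and "bil (g \<phi> p) u v = bil (h \<psi> (f p)) (dird u F (coords \<phi> p)) (dird v F (coords \<phi> p))"
proof -
  have d: "F differentiable (at (coords \<phi> p))"
    using assms by (intro smooth_on_differentiable[OF smooth_loc_rep]) auto
  have "inj ((*v) (jac_at \<phi> \<psi> f p)) \<and> g \<phi> p = pullback (jac_at \<phi> \<psi> f p) (h \<psi> (f p))"
    using hypersurface(2) charts assms unfolding isometric_immersion_def by blast
  moreover have "(*v) (jac_at \<phi> \<psi> f p) = (\<lambda>u. dird u F (coords \<phi> p))"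
    by (simp add: fun_eq_iff jacobian_mult[OF d])
  ultimately show "inj (\<lambda>u. dird u F (coords \<phi> p))"
    and "bil (g \<phi> p) u v = bil (h \<psi> (f p)) (dird u F (coords \<phi> p)) (dird v F (coords \<phi> p))"
    by (simp_all add: jacobian_mult[OF d] bil_pullback)
qed

lemma isometric_coord_map: "isometric_coord_map (coords \<psi> ` dom_ch \<psi>) hc U F gc"
proof -
  interpret h: coord_metric "coords \<psi> ` dom_ch \<psi>" hc
    by (rule riemannian_manifold_coord_metric[OF ambient(1) charts(2)])
  interpret g: coord_metric U gc
    by (rule coord_metric_subset[OF riemannian_manifold_coord_metric[OF hypersurface(1) charts(1)] open_dom]) blast
  show ?thesis
  proof
    show "smooth_on U F" by (rule smooth_loc_rep)
    show "F x \<in> coords \<psi> ` dom_ch \<psi>" if "x \<in> U" for x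
      using that by (auto simp: F_coords)
    show "bil (gc x) u v = bil (hc (F x)) (dird u F x) (dird v F x)" if "x \<in> U" for x u v
    proof -
      obtain p where p: "x = coords \<phi> p" "p \<in> dom_ch \<phi>" "f p \<in> dom_ch \<psi>" using \<open>x \<in> U\<close> by auto
      show ?thesis
        using immersion(2)[OF p(2,3)] chart p by (simp add: F_coords)
    qed
  qed (rule open_dom)
qed

lemma ambient_hessian_eq:
  assumes p: "p \<in> dom_ch \<phi>" "f p \<in> dom_ch \<psi>"
  shows "ambient_hessian h f \<phi> \<psi> p i j = hess hc F (axis i 1) (axis j 1) (coords \<phi> p)"
proof -
  let ?x = "coords \<phi> p"
  interpret isometric_coord_map "coords \<psi> ` dom_ch \<psi>" hc U F gc by (rule isometric_coord_map)
  have x: "?x \<in> U" using p by auto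
  have P: "partial j (\<lambda>y. F y $ a) y = dird (axis j 1) F y $ a" if "y \<in> U" for y j a
    by (rule partial_nth[OF diff_F[OF that]])
  \<comment> \<open>The inner partial derivative is known to be a component of \<open>dird\<close>
    only on \<open>U\<close>, so the outer one is compared on that open set.\<close>
  have "partial i (partial j (\<lambda>y. F y $ a)) ?x = dird (axis i 1) (dird (axis j 1) F) ?x $ a" for a
  proof -
    have "partial i (partial j (\<lambda>y. F y $ a)) ?x = dird (axis i 1) (\<lambda>y. dird (axis j 1) F y $ a) ?x"
      unfolding partial_def[of i]
      by (rule dird_cong_open[OF open_U x, symmetric]) (simp_all add: P differentiable_nth[OF diff_P[OF x]])
    then show ?thesis by (simp add: dird_bounded_linear[OF bounded_linear_vec_nth diff_P[OF x]])
  qed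
  then show ?thesis
    by (simp add: ambient_hessian_def Let_def hess_def vec_eq_iff P[OF x] conn_def bil_def christoffel_mat_def)
qed

lemma H_nth:
  assumes p: "p \<in> dom_ch \<phi>" "f p \<in> dom_ch \<psi>"
  shows "H \<phi> p $ i $ j = bil (h \<psi> (f p)) (hess hc F (axis i 1) (axis j 1) (coords \<phi> p)) (\<nu> \<psi> p)"
proof -
  have "H \<phi> p = (\<chi> i j. bil (h \<psi> (f p)) (ambient_hessian h f \<phi> \<psi> p i j) (\<nu> \<psi> p))"
    using H charts p unfolding second_fundamental_tensor_def by blast
  then show ?thesis by (simp add: ambient_hessian_eq[OF p])
qed

lemma H_sym_charts:
  assumes p: "p \<in> dom_ch \<phi>" "f p \<in> dom_ch \<psi>"
  shows "transpose (H \<phi> p) = H \<phi> p"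
proof -
  interpret isometric_coord_map "coords \<psi> ` dom_ch \<psi>" hc U F gc by (rule isometric_coord_map)
  have x: "coords \<phi> p \<in> U" using p by auto
  have "H \<phi> p $ j $ i = H \<phi> p $ i $ j" for i j
    unfolding H_nth[OF p] using hess_sym[OF x, of "axis i 1" "axis j 1"] by simp
  then show ?thesis by (simp add: transpose_def vec_eq_iff)
qed

text \<open>Constant curvature expresses the ambient term by inner products of vectors
  \<open>df\<close>, and isometry turns these into \<open>G_tensor\<close> of the induced
  metric.\<close>

lemma gauss_charts:
  assumes p: "p \<in> dom_ch \<phi>" "f p \<in> dom_ch \<psi>"
  shows "curv g \<phi> p l i j k = H \<phi> p $ i $ j * H \<phi> p $ l $ k - H \<phi> p $ l $ j * H \<phi> p $ i $ k
    + c * G_tensor (g \<phi> p) l i j k"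
proof -
  interpret isometric_coord_map "coords \<psi> ` dom_ch \<psi>" hc U F gc by (rule isometric_coord_map)
  let ?x = "coords \<phi> p"
  have x: "?x \<in> U" using p by auto
  have gx: "gc ?x = g \<phi> p" using chart p by simp
  have hx: "hc (F ?x) = h \<psi> (f p)" using chart p by (simp add: F_coords)
  have d: "F differentiable (at ?x)" by (rule diff_F[OF x])
  have hx': "hc (coords \<psi> (f p)) = h \<psi> (f p)" using chart p by simp
  have n: "bil (h \<psi> (f p)) (\<nu> \<psi> p) (\<nu> \<psi> p) = 1 \<and>
      (\<forall>u. bil (h \<psi> (f p)) (jac_at \<phi> \<psi> f p *v u) (\<nu> \<psi> p) = 0)"
    using normal charts p unfolding unit_normal_def by blast
  then have n1: "bil (h \<psi> (f p)) (\<nu> \<psi> p) (\<nu> \<psi> p) = 1"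
    and n2: "bil (h \<psi> (f p)) (dird u F ?x) (\<nu> \<psi> p) = 0" for u
    by (simp_all add: jacobian_mult[OF d])
  note gauss = gauss_hypersurface[OF x codim immersion(1)[OF p], unfolded F_coords[OF p(1)] hx', OF n1 n2]
  have "curv g \<phi> p l i j k = bil (gc ?x) (curv_op gc ?x (axis l 1) (axis i 1) (axis j 1)) (axis k 1)"
    unfolding curv_def by (rule g.riemann_coord_eq[OF x])
  also have "\<dots> = c * (bil (g \<phi> p) (axis l 1) (axis k 1) * bil (g \<phi> p) (axis i 1) (axis j 1)
       - bil (g \<phi> p) (axis l 1) (axis j 1) * bil (g \<phi> p) (axis i 1) (axis k 1))
      + H \<phi> p $ i $ j * H \<phi> p $ l $ k - H \<phi> p $ l $ j * H \<phi> p $ i $ k"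
    unfolding gauss constant_curvature_coord[OF ambient charts(2) p(2)] H_nth[OF p] immersion(2)[OF p] ..
  finally show ?thesis by (simp add: bil_axis G_tensor_def)
qed

end

lemma H_sym:
  assumes "\<phi> \<in> \<A>" "p \<in> dom_ch \<phi>"
  shows "transpose (H \<phi> p) = H \<phi> p"
proof -
  obtain \<psi> where "\<psi> \<in> \<B>" "f p \<in> dom_ch \<psi>" using ambient_chart[OF assms] .
  then show ?thesis by (rule H_sym_charts[OF assms(1) _ assms(2)])
qed

theorem gauss_equation:
  assumes "\<phi> \<in> \<A>" "p \<in> dom_ch \<phi>"
  shows "curv g \<phi> p l i j k
    = H \<phi> p $ i $ j * H \<phi> p $ l $ k - H \<phi> p $ l $ j * H \<phi> p $ i $ k + c * G_tensor (g \<phi> p) l i j k"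
proof -
  obtain \<psi> where "\<psi> \<in> \<B>" "f p \<in> dom_ch \<psi>" using ambient_chart[OF assms] .
  then show ?thesis by (rule gauss_charts[OF assms(1) _ assms(2)])
qed

lemma ricci_hypersurface:
  assumes "\<phi> \<in> \<A>" "p \<in> dom_ch \<phi>"
  shows "ricci g \<phi> p = tr_tensor (g \<phi> p) (H \<phi> p) *\<^sub>R H \<phi> p - sq_tensor (g \<phi> p) (H \<phi> p)
    + ((real CARD('n) - 1) * c) *\<^sub>R g \<phi> p"
  unfolding ricci_def
  by (rule ricci_contraction[OF riemannian_manifold_posdef[OF hypersurface(1) assms] gauss_equation[OF assms]])

end

theorem theorem8p1:
  fixes X :: "'m topology" and \<A> :: "('m, 'n::finite) chart set" and g H A :: "('m, 'n) tensor2"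
    and Y :: "'q topology" and \<B> :: "('q, 'k::finite) chart set" and h :: "('q, 'k) tensor2"
    and f :: "'m \<Rightarrow> 'q" and \<nu> :: "('q, 'k) chart \<Rightarrow> 'm \<Rightarrow> real ^ 'k"
    and lam0 lam1 lam2 \<alpha> \<beta> \<gamma> trH \<mu> :: "'m \<Rightarrow> real"
    and c :: real and n n1 n2 :: nat
  assumes dim: "n = CARD('n)" "n \<ge> 3" "CARD('k) = n + 1"
    and ambient: "riemannian_manifold Y \<B> h" "constant_curvature \<B> h c"
    and hypersurface: "riemannian_manifold X \<A> g" "connected_space X"
      "isometric_immersion X \<A> g Y \<B> h f"
    and normal: "unit_normal \<A> \<B> h f \<nu>"
    and H: "second_fundamental_tensor \<A> \<B> h f \<nu> H"
    and distinct_curvatures: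
      "\<And>p. p \<in> topspace X \<Longrightarrow> lam0 p \<noteq> lam1 p \<and> lam0 p \<noteq> lam2 p \<and> lam1 p \<noteq> lam2 p"
    and principal_curvatures:
      "\<And>\<phi> p. \<phi> \<in> \<A> \<Longrightarrow> p \<in> dom_ch \<phi> \<Longrightarrow>
         eigenvalues (shape_operator (g \<phi> p) (H \<phi> p)) = {lam0 p, lam1 p, lam2 p}"
    and multiplicities:
      "\<And>\<phi> p. \<phi> \<in> \<A> \<Longrightarrow> p \<in> dom_ch \<phi> \<Longrightarrow>
         dim (eigenspace (shape_operator (g \<phi> p) (H \<phi> p)) (lam0 p)) = 1 \<and>
         dim (eigenspace (shape_operator (g \<phi> p) (H \<phi> p)) (lam1 p)) = n1 \<and>
         dim (eigenspace (shape_operator (g \<phi> p) (H \<phi> p)) (lam2 p)) = n2"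
    and \<alpha>_def: "\<alpha> = (\<lambda>p. lam0 p + lam1 p + lam2 p)"
    and \<beta>_def: "\<beta> = (\<lambda>p. - lam0 p * (lam1 p + lam2 p) - lam1 p * lam2 p)"
    and \<gamma>_def: "\<gamma> = (\<lambda>p. lam0 p * lam1 p * lam2 p)"
    and trH_def: "trH = trace_fn \<A> g H"
    and A_def: "A = (\<lambda>\<phi> p.
         sq_tensor (g \<phi> p) (ricci g \<phi> p)
         + ((\<alpha> p - trH p)\<^sup>2 + \<beta> p - 2 * (real n - 1) * c) *\<^sub>R ricci g \<phi> p
         + ((real n - 1)\<^sup>2 * c\<^sup>2 - (\<beta> p + (\<alpha> p - trH p)\<^sup>2) * (real n - 1) * c
            - \<gamma> p * (\<alpha> p - 2 * trH p)) *\<^sub>R g \<phi> p)"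
    and \<mu>_def: "\<mu> = (\<lambda>p. \<gamma> p + (\<alpha> p - trH p) * (\<beta> p + trH p * (\<alpha> p - trH p)))"
  shows "(\<forall>\<phi>\<in>\<A>. \<forall>p\<in>dom_ch \<phi>. A \<phi> p = \<mu> p *\<^sub>R H \<phi> p)
    \<and> (\<forall>p\<in>topspace X. \<mu> p =
          (lam0 p + (real n1 - 1) * lam1 p + (real n2 - 1) * lam2 p) *
          (lam1 p * lam2 p + (real n1 * lam1 p + real n2 * lam2 p) *
             ((real n1 - 1) * lam1 p + (real n2 - 1) * lam2 p)))
    \<and> (\<forall>x\<in>topspace X. \<mu> x = 0 \<longrightarrow> partially_einstein_at \<A> g x)
    \<and> (\<forall>x\<in>topspace X. \<mu> x \<noteq> 0 \<longrightarrow>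
          (\<exists>U. openin X U \<and> x \<in> U \<and>
             (\<forall>p\<in>U. \<mu> p \<noteq> 0 \<and>
                (\<forall>\<phi>\<in>\<A>. p \<in> dom_ch \<phi> \<longrightarrow>
                   (\<forall>l i j k. curv g \<phi> p l i j k =
                      1 / (2 * (\<mu> p)\<^sup>2) * kulkarni_nomizu (A \<phi> p) (A \<phi> p) l i j k
                      + c * G_tensor (g \<phi> p) l i j k)))))"
proof -
  interpret hs: space_form_hypersurface X \<A> g H Y \<B> h f \<nu> c
    using dim ambient hypersurface normal H by unfold_locales auto
  define k where "k = (real n - 1) * c"
  define a where "a = (\<lambda>p. (\<alpha> p - trH p)\<^sup>2 + \<beta> p - 2 * k)"
  define b where "b = (\<lambda>p. k\<^sup>2 - (\<beta> p + (\<alpha> p - trH p)\<^sup>2) * k - \<gamma> p * (\<alpha> p - 2 * trH p))"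
  have A_eq: "A = (\<lambda>\<phi> p. sq_tensor (g \<phi> p) (ricci g \<phi> p) + a p *\<^sub>R ricci g \<phi> p + b p *\<^sub>R g \<phi> p)"
    unfolding A_def a_def b_def k_def by (simp only: power_mult_distrib mult.assoc)
  have in_X: "p \<in> topspace X" if "\<phi> \<in> \<A>" "p \<in> dom_ch \<phi>" for \<phi> p
    using is_chart_inj(2)[OF riemannian_manifold_chart[OF hypersurface(1) that(1)]] that(2) by blast
  have chart_at: "\<exists>\<phi>\<in>\<A>. p \<in> dom_ch \<phi>" if "p \<in> topspace X" for p
    using hypersurface(1) that unfolding riemannian_manifold_def smooth_manifold_def by blast
  have three: "three_curvatures (g \<phi> p) (H \<phi> p) (lam0 p) (lam1 p) (lam2 p) n1 n2"
    if "\<phi> \<in> \<A>" "p \<in> dom_ch \<phi>" for \<phi> p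
    using riemannian_manifold_posdef[OF hypersurface(1) that] hs.H_sym[OF that]
      distinct_curvatures[OF in_X[OF that]] principal_curvatures[OF that] multiplicities[OF that]
    by unfold_locales auto
  \<comment> \<open>\<open>trace_fn\<close> evaluates in one chosen chart; \<open>trace_H\<close>
    expresses the trace by data of the point alone, so every chart gives the same value.\<close>
  have tr: "tr_tensor (g \<phi> p) (H \<phi> p) = trH p" if "\<phi> \<in> \<A>" "p \<in> dom_ch \<phi>" for \<phi> p
  proof -
    define \<psi> where "\<psi> = (SOME \<phi>. \<phi> \<in> \<A> \<and> p \<in> dom_ch \<phi>)"
    have \<psi>: "\<psi> \<in> \<A> \<and> p \<in> dom_ch \<psi>" unfolding \<psi>_def by (rule someI) (use that in blast)
    have "trH p = tr_tensor (g \<psi> p) (H \<psi> p)" by (simp add: trH_def trace_fn_def \<psi>_def Let_def)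
    then show ?thesis
      using three_curvatures.trace_H[OF three[OF that]] three_curvatures.trace_H[OF three] \<psi> by metis
  qed
  have S: "ricci g \<phi> p = tr_tensor (g \<phi> p) (H \<phi> p) *\<^sub>R H \<phi> p - sq_tensor (g \<phi> p) (H \<phi> p) + k *\<^sub>R g \<phi> p"
    if "\<phi> \<in> \<A>" "p \<in> dom_ch \<phi>" for \<phi> p
    using hs.ricci_hypersurface[OF that] by (simp add: k_def dim(1))
  have A_mu: "A \<phi> p = \<mu> p *\<^sub>R H \<phi> p" if "\<phi> \<in> \<A>" "p \<in> dom_ch \<phi>" for \<phi> p
    using three_curvatures.quadratic_in_S[OF three[OF that] S[OF that], of "\<alpha> p" "\<beta> p" "\<gamma> p"]
    unfolding A_eq \<mu>_def a_def b_def tr[OF that] by (simp add: \<alpha>_def \<beta>_def \<gamma>_def)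
  have mu_factors: "\<mu> p = (trH p - lam1 p - lam2 p) * (trH p - lam0 p - lam1 p) * (trH p - lam0 p - lam2 p)"
    if "\<phi> \<in> \<A>" "p \<in> dom_ch \<phi>" for \<phi> p
    using three_curvatures.mu_factors[OF three[OF that]] unfolding tr[OF that] \<mu>_def \<alpha>_def \<beta>_def \<gamma>_def .
  have mu: "\<mu> p = (lam0 p + (real n1 - 1) * lam1 p + (real n2 - 1) * lam2 p) *
          (lam1 p * lam2 p + (real n1 * lam1 p + real n2 * lam2 p) *
             ((real n1 - 1) * lam1 p + (real n2 - 1) * lam2 p))" if p: "p \<in> topspace X" for p
  proof -
    obtain \<phi> where \<phi>: "\<phi> \<in> \<A>" "p \<in> dom_ch \<phi>" using chart_at[OF p] by blast
    show ?thesis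
      using three_curvatures.mu_multiplicities[OF three[OF \<phi>]] unfolding tr[OF \<phi>] mu_factors[OF \<phi>] .
  qed
  have einstein: "partially_einstein_at \<A> g x" if x: "x \<in> topspace X" "\<mu> x = 0" for x
    unfolding partially_einstein_at_def
  proof
    obtain \<phi> where \<phi>: "\<phi> \<in> \<A>" "x \<in> dom_ch \<phi>" using chart_at[OF x(1)] by blast
    then show "\<not> (\<exists>\<kappa>. \<forall>\<phi>\<in>\<A>. x \<in> dom_ch \<phi> \<longrightarrow> ricci g \<phi> x = \<kappa> *\<^sub>R g \<phi> x)"
      using three_curvatures.S_not_proportional[OF three[OF \<phi>] S[OF \<phi>]] by blast
    \<comment> \<open>The coefficients \<open>- a x\<close> and \<open>- b x\<close> depend on the
      point alone, so one pair serves all charts, as the definition demands.\<close>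
    have "sq_tensor (g \<phi> x) (ricci g \<phi> x) = (- a x) *\<^sub>R ricci g \<phi> x + (- b x) *\<^sub>R g \<phi> x"
      if \<phi>: "\<phi> \<in> \<A>" "x \<in> dom_ch \<phi>" for \<phi>
      using A_mu[OF \<phi>] x(2) unfolding A_eq by (simp add: algebra_simps eq_neg_iff_add_eq_0)
    then show "\<exists>lam nu. \<forall>\<phi>\<in>\<A>. x \<in> dom_ch \<phi> \<longrightarrow>
        sq_tensor (g \<phi> x) (ricci g \<phi> x) = lam *\<^sub>R ricci g \<phi> x + nu *\<^sub>R g \<phi> x" by blast
  qed
  have curvature: "curv g \<phi> p l i j k = 1 / (2 * (\<mu> p)\<^sup>2) * kulkarni_nomizu (A \<phi> p) (A \<phi> p) l i j k
        + c * G_tensor (g \<phi> p) l i j k"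
    if "\<mu> p \<noteq> 0" "\<phi> \<in> \<A>" "p \<in> dom_ch \<phi>" for \<phi> p l i j k
  proof -
    \<comment> \<open>Each slot carries a factor \<open>\<mu> p\<close>, and the product of
      \<open>H\<close> with itself counts every term twice; hence
      \<open>2 * (\<mu> p)\<^sup>2\<close>.\<close>
    have "kulkarni_nomizu (A \<phi> p) (A \<phi> p) l i j k
        = 2 * (\<mu> p)\<^sup>2 * (H \<phi> p $ i $ j * H \<phi> p $ l $ k - H \<phi> p $ l $ j * H \<phi> p $ i $ k)"
      unfolding A_mu[OF that(2,3)] kulkarni_nomizu_def by (simp add: algebra_simps power2_eq_square)
    then show ?thesis using that(1) hs.gauss_equation[OF that(2,3), of l i j k] by simp
  qed
  have nonzero_nhd: "\<exists>U. openin X U \<and> x \<in> U \<and> (\<forall>p\<in>U. \<mu> p \<noteq> 0)"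
    if x: "x \<in> topspace X" "\<mu> x \<noteq> 0" for x
  proof -
    obtain \<phi> where \<phi>: "\<phi> \<in> \<A>" "x \<in> dom_ch \<phi>" using chart_at[OF x(1)] by blast
    let ?V = "coords \<phi> ` dom_ch \<phi>" and ?g = "g \<phi> \<circ> uncoords \<phi>"
    interpret coord_metric ?V ?g
      by (rule riemannian_manifold_coord_metric[OF hypersurface(1) \<phi>(1)])
    note chart = riemannian_manifold_chart[OF hypersurface(1) \<phi>(1)]
    \<comment> \<open>\<open>S_independent\<close> puts the coordinates of \<open>x\<close> into
      \<open>W\<close>. Conversely \<open>\<mu> p = 0\<close> is impossible over \<open>W\<close>:
      there \<open>A = 0\<close> would be a linear relation with coefficient \<open>1\<close> at the
      square of the Ricci tensor.\<close>
    define W where "W = {y \<in> ?V. independent3 (sq_tensor (?g y) (ricci_coord ?g y)) (ricci_coord ?g y) (?g y)}"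
    have "open W" unfolding W_def
      by (intro open_independent3 open_V continuous_on_sq_tensor continuous_on_ricci_coord
          smooth_on_continuous smooth)
    then have "openin X {p \<in> dom_ch \<phi>. coords \<phi> p \<in> W}" by (rule openin_chart_preimage[OF chart])
    moreover have W_iff: "coords \<phi> p \<in> W \<longleftrightarrow> independent3 (sq_tensor (g \<phi> p) (ricci g \<phi> p)) (ricci g \<phi> p) (g \<phi> p)"
      if "p \<in> dom_ch \<phi>" for p
      using that chart by (simp add: W_def ricci_eq_ricci_coord[OF chart that])
    moreover have "coords \<phi> x \<in> W"
      unfolding W_iff[OF \<phi>(2)] independent3_def
      using three_curvatures.S_independent[OF three[OF \<phi>] S[OF \<phi>]] x(2)
      unfolding tr[OF \<phi>] mu_factors[OF \<phi>] by blast
    moreover have "\<mu> p \<noteq> 0" if p: "p \<in> dom_ch \<phi>" "coords \<phi> p \<in> W" for p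
    proof
      assume "\<mu> p = 0"
      then have "1 *\<^sub>R sq_tensor (g \<phi> p) (ricci g \<phi> p) + a p *\<^sub>R ricci g \<phi> p + b p *\<^sub>R g \<phi> p = 0"
        using A_mu[OF \<phi>(1) p(1)] unfolding A_eq by simp
      then show False using p(2) unfolding W_iff[OF p(1)] independent3_def by (metis zero_neq_one)
    qed
    ultimately show ?thesis using \<phi>(2) by (intro exI[of _ "{p \<in> dom_ch \<phi>. coords \<phi> p \<in> W}"]) blast
  qed
  show ?thesis
  proof (intro conjI ballI impI)
    fix x assume "x \<in> topspace X" "\<mu> x \<noteq> 0"
    from nonzero_nhd[OF this] obtain U where "openin X U" "x \<in> U" "\<forall>p\<in>U. \<mu> p \<noteq> 0" by blast
    then show "\<exists>U. openin X U \<and> x \<in> U \<and> (\<forall>p\<in>U. \<mu> p \<noteq> 0 \<and>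
        (\<forall>\<phi>\<in>\<A>. p \<in> dom_ch \<phi> \<longrightarrow> (\<forall>l i j k. curv g \<phi> p l i j k =
          1 / (2 * (\<mu> p)\<^sup>2) * kulkarni_nomizu (A \<phi> p) (A \<phi> p) l i j k + c * G_tensor (g \<phi> p) l i j k)))"
      using curvature by (intro exI[of _ U]) blast
  qed (fact A_mu mu einstein)+
qed

end
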